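(* Let $p>-1$ and $\psi_p(s)=|s|^p$. For every integer $n\ge0$, $$\lambda_{2n}(\psi_p)=c_{d,p}\,\frac{(-1)^n(-p/2)_n}{((d+p)/2)_n},\qquad \lambda_{2n+1}(\psi_p)=0,$$ where $$c_{d,p}=\frac{\Gamma(d/2)\,\Gamma((p+1)/2)}{\sqrt\pi\,\Gamma((d+p)/2)}.$$
   Context: Fix an integer $d\ge 2$. $\sigma$ is the normalized rotation-invariant Borel probability measure on the unit sphere $\mathbb S^{d-1}\subset\mathbb R^d$. $\mathcal H_\ell$ denotes the space of restrictions to $\mathbb S^{d-1}$ of real homogeneous harmonic polynomials of degree $\ell$ on $\mathbb R^d$. The Funk--Hecke multiplier $\lambda_\ell(\psi)$ of a kernel $\psi$ is the scalar such that $$\int_{\mathbb S^{d-1}}\psi(\langle u,v\rangle)Y(v)\,d\sigma(v)=\lambda_\ell(\psi)Y(u)\qquad\text{for all }Y\in\mathcal H_\ell,\ u\in\mathbb S^{d-1}$$ (for $-1<p<0$ the integrals with $\psi=\psi_p$ are absolutely convergent Lebesgue integrals). $|s|^0$ is understood as the constant $1$. $(a)_n$ is the Pochhammer symbol, $(a)_n=a(a+1)\cdots(a+n-1)$, $(a)_0=1$, equal to $\Gamma(a+n)/\Gamma(a)$ whenever the latter is defined. *)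

theory Defs
  imports "HOL-Probability.Probability"
begin

definition rotation_invariant_sphere_prob :: "(real ^ 'd) measure \<Rightarrow> bool" where
  "rotation_invariant_sphere_prob \<sigma> \<longleftrightarrow>
     prob_space \<sigma> \<and>
     sets \<sigma> = sets (restrict_space borel (sphere 0 1)) \<and>
     (\<forall>Q. rotation_matrix Q \<longrightarrow> distr \<sigma> \<sigma> (\<lambda>v. Q *v v) = \<sigma>)"

(* The next three lemmas show that such a measure exists, so that assuming the predicate
   is never vacuous; it is realised as the radial projection of the uniform measure on the
   unit ball.  The orthogonal change of variables in HOL-Analysis needs a well-ordered index
   type, hence the direct proof. *)
lemma lborel_distr_rotation:
  fixes Q :: "real ^ 'd ^ 'd"
  assumes Q: "rotation_matrix Q"
  shows "distr lborel borel (\<lambda>v. Q *v v) = lborel"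
proof (rule measure_eqI)
  have Q': "orthogonal_matrix Q" using Q by (simp add: rotation_matrix_def)
  have QT: "Q *v (transpose Q *v x) = x" for x
    using Q' by (simp add: orthogonal_matrix_def matrix_vector_mul_assoc del: transpose_matrix_vector)
  have ot: "orthogonal_transformation (\<lambda>v. Q *v v)"
    using Q' by (simp add: orthogonal_transformation_matrix)
  have n: "norm (Q *v v) = norm v" for v using ot by (simp add: orthogonal_transformation)
  have m[measurable]: "(\<lambda>v. Q *v v) \<in> borel_measurable borel"
    by (intro borel_measurable_continuous_onI linear_continuous_on matrix_vector_mul_bounded_linear)
  have tr: "(\<integral>\<^sup>+x. F (a + x) \<partial>lborel) = (\<integral>\<^sup>+x. F x \<partial>lborel)"
    if [measurable]: "F \<in> borel_measurable borel" for F :: "real ^ 'd \<Rightarrow> ennreal" and a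
  proof -
    have "(\<integral>\<^sup>+x. F x \<partial>lborel) = (\<integral>\<^sup>+x. F x \<partial>distr lborel borel ((+) a))"
      by (simp add: lborel_distr_plus)
    also have "\<dots> = (\<integral>\<^sup>+x. F (a + x) \<partial>lborel)" by (subst nn_integral_distr) auto
    finally show ?thesis ..
  qed
  fix A :: "(real ^ 'd) set" assume "A \<in> sets (distr lborel borel (\<lambda>v. Q *v v))"
  then have A[measurable]: "A \<in> sets borel" by simp
  define f :: "real ^ 'd \<Rightarrow> ennreal" where "f = indicator A"
  define g :: "real ^ 'd \<Rightarrow> ennreal" where "g = indicator (ball 0 1)"
  have f[measurable]: "f \<in> borel_measurable borel" and g[measurable]: "g \<in> borel_measurable borel"
    unfolding f_def g_def by (auto intro!: borel_measurable_indicator)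
  have gQ: "g (Q *v y) = g y" for y by (simp add: g_def n indicator_def)
  have gm: "g (x - y) = g (y - x)" for x y by (simp add: g_def indicator_def norm_minus_commute)
  let ?b = "\<integral>\<^sup>+x. g x \<partial>lborel"
  have b: "?b = emeasure lborel (ball (0 :: real ^ 'd) 1)" by (simp add: g_def)
  have "(\<integral>\<^sup>+x. f x \<partial>lborel) * ?b = (\<integral>\<^sup>+y. g (Q *v y) * (\<integral>\<^sup>+x. f x \<partial>lborel) \<partial>lborel)"
    by (subst nn_integral_multc) (auto simp: gQ mult.commute)
  also have "\<dots> = (\<integral>\<^sup>+y. (\<integral>\<^sup>+x. g (Q *v y) * f (Q *v y + x) \<partial>lborel) \<partial>lborel)"
    by (simp add: nn_integral_cmult tr)
  also have "\<dots> = (\<integral>\<^sup>+x. (\<integral>\<^sup>+y. g (Q *v y) * f (Q *v y + x) \<partial>lborel) \<partial>lborel)"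
    by (rule lborel_pair.Fubini') measurable
  also have "\<dots> = (\<integral>\<^sup>+x. (\<integral>\<^sup>+y. g (Q *v y - x) * f (Q *v y) \<partial>lborel) \<partial>lborel)"
  proof (rule nn_integral_cong)
    fix x
    show "(\<integral>\<^sup>+y. g (Q *v y) * f (Q *v y + x) \<partial>lborel) = (\<integral>\<^sup>+y. g (Q *v y - x) * f (Q *v y) \<partial>lborel)"
      using tr[of "\<lambda>y. g (Q *v y) * f (Q *v y + x)" "- (transpose Q *v x)"]
      by (simp add: matrix_vector_right_distrib matrix_vector_mult_diff_distrib QT algebra_simps del: transpose_matrix_vector)
  qed
  also have "\<dots> = (\<integral>\<^sup>+y. (\<integral>\<^sup>+x. g (Q *v y - x) * f (Q *v y) \<partial>lborel) \<partial>lborel)"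
    by (rule lborel_pair.Fubini'[symmetric]) measurable
  also have "\<dots> = (\<integral>\<^sup>+y. ?b * f (Q *v y) \<partial>lborel)"
  proof (rule nn_integral_cong)
    fix y
    show "(\<integral>\<^sup>+x. g (Q *v y - x) * f (Q *v y) \<partial>lborel) = ?b * f (Q *v y)"
      using tr[of g "- (Q *v y)"] by (simp add: nn_integral_multc gm[of "Q *v y"])
  qed
  also have "\<dots> = (\<integral>\<^sup>+y. f (Q *v y) \<partial>lborel) * ?b"
    by (simp add: nn_integral_cmult mult.commute)
  finally have "(\<integral>\<^sup>+x. f x \<partial>lborel) * ?b = (\<integral>\<^sup>+y. f (Q *v y) \<partial>lborel) * ?b" .
  moreover have "?b \<noteq> 0"
    using open_not_negligible[of "ball (0 :: real ^ 'd) 1"] by (simp add: b negligible_iff_emeasure0)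
  moreover have "?b \<noteq> top"
    unfolding b using emeasure_lborel_ball_finite[of "0 :: real ^ 'd" 1] by simp
  ultimately have "(\<integral>\<^sup>+y. f (Q *v y) \<partial>lborel) = (\<integral>\<^sup>+x. f x \<partial>lborel)"
    by (metis ennreal_mult_divide_eq)
  moreover have "(\<integral>\<^sup>+y. f (Q *v y) \<partial>lborel) = (\<integral>\<^sup>+x. f x \<partial>distr lborel borel (\<lambda>v. Q *v v))"
    by (subst nn_integral_distr) auto
  ultimately show "emeasure (distr lborel borel (\<lambda>v. Q *v v)) A = emeasure lborel A"
    by (simp add: f_def)
qed simp

lemma emeasure_lborel_ball_rotation:
  fixes Q :: "real ^ 'd ^ 'd"
  assumes Q: "rotation_matrix Q" and A: "A \<in> sets borel"
  shows "emeasure lborel (ball 0 1 \<inter> (\<lambda>v. Q *v v) -` A) = emeasure lborel (ball 0 1 \<inter> A)"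
proof -
  have ot: "orthogonal_transformation (\<lambda>v. Q *v v)"
    using Q by (simp add: orthogonal_transformation_matrix rotation_matrix_def)
  have n: "norm (Q *v v) = norm v" for v using ot by (simp add: orthogonal_transformation)
  have m: "(\<lambda>v. Q *v v) \<in> borel_measurable borel"
    by (intro borel_measurable_continuous_onI linear_continuous_on matrix_vector_mul_bounded_linear)
  have "emeasure lborel (ball 0 1 \<inter> A) = emeasure (distr lborel borel (\<lambda>v. Q *v v)) (ball 0 1 \<inter> A)"
    by (simp only: lborel_distr_rotation[OF Q])
  also have "\<dots> = emeasure lborel ((\<lambda>v. Q *v v) -` (ball 0 1 \<inter> A))"
    using A m by (subst emeasure_distr) auto
  also have "(\<lambda>v. Q *v v) -` (ball 0 1 \<inter> A) = ball 0 1 \<inter> (\<lambda>v. Q *v v) -` A"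
    by (auto simp: n)
  finally show ?thesis ..
qed

lemma rotation_invariant_sphere_prob_exists:
  "\<exists>\<sigma> :: (real ^ 'd) measure. rotation_invariant_sphere_prob \<sigma>"
proof -
  define f where "f = (\<lambda>x :: real ^ 'd. if x = 0 then axis undefined 1 else x /\<^sub>R norm x)"
  define U where "U = uniform_measure lborel (ball (0 :: real ^ 'd) 1)"
  define S where "S = restrict_space borel (sphere (0 :: real ^ 'd) 1)"
  have fin: "emeasure lborel (ball (0 :: real ^ 'd) 1) < \<infinity>"
    by (rule emeasure_lborel_ball_finite)
  have pos: "emeasure lborel (ball (0 :: real ^ 'd) 1) \<noteq> 0"
    using emeasure_lborel_ball_finite open_not_negligible[of "ball (0 :: real ^ 'd) 1"]
    by (simp add: negligible_iff_emeasure0)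
  interpret U: prob_space U
    unfolding U_def by (rule prob_space_uniform_measure) (use fin pos in auto)
  have sU[measurable_cong]: "sets U = sets borel" by (simp add: U_def)
  have f[measurable]: "f \<in> measurable U S"
    unfolding S_def
  proof (rule measurable_restrict_space2)
    show "f \<in> space U \<rightarrow> sphere 0 1" by (auto simp: f_def)
    show "f \<in> borel_measurable U" unfolding f_def by measurable
  qed
  let ?\<sigma> = "distr U S f"
  have "distr ?\<sigma> ?\<sigma> (\<lambda>v. Q *v v) = ?\<sigma>" if Q: "rotation_matrix Q" for Q
  proof -
    have ot: "orthogonal_transformation (\<lambda>v. Q *v v)"
      using Q by (simp add: orthogonal_transformation_matrix rotation_matrix_def)
    have n: "norm (Q *v v) = norm v" for v using ot by (simp add: orthogonal_transformation)
    have m: "(\<lambda>v. Q *v v) \<in> borel_measurable borel"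
      by (intro borel_measurable_continuous_onI linear_continuous_on matrix_vector_mul_bounded_linear)
    have mU: "(\<lambda>v. Q *v v) \<in> measurable U U"
      using m by (simp cong: measurable_cong_sets add: sU)
    have mS: "(\<lambda>v. Q *v v) \<in> measurable S S"
      unfolding S_def using m
      by (intro measurable_restrict_space2 measurable_restrict_space1) (auto simp: n space_restrict_space)
    have U: "distr U U (\<lambda>v. Q *v v) = U"
    proof (rule measure_eqI)
      fix A assume "A \<in> sets (distr U U (\<lambda>v. Q *v v))"
      then have A: "A \<in> sets borel" by (simp add: sU)
      have "(\<lambda>v. Q *v v) -` A \<in> sets borel" using measurable_sets[OF m A] by simp
      then show "emeasure (distr U U (\<lambda>v. Q *v v)) A = emeasure U A"
        using A emeasure_lborel_ball_rotation[OF Q A] mU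
        by (simp add: emeasure_distr sU) (simp add: U_def)
    qed simp
    have ae: "AE x in U. x \<noteq> 0"
    proof -
      have "AE x in lborel. x \<noteq> (0 :: real ^ 'd)" by (rule AE_lborel_singleton)
      then show ?thesis unfolding U_def by (intro AE_uniform_measureI) auto
    qed
    have "distr ?\<sigma> ?\<sigma> (\<lambda>v. Q *v v) = distr ?\<sigma> S (\<lambda>v. Q *v v)"
      by (rule distr_cong) auto
    also have "\<dots> = distr U S ((\<lambda>v. Q *v v) \<circ> f)" by (rule distr_distr[OF mS f])
    also have "\<dots> = distr U S (f \<circ> (\<lambda>v. Q *v v))"
    proof (rule distr_cong_AE)
      show "AE x in U. ((\<lambda>v. Q *v v) \<circ> f) x = (f \<circ> (\<lambda>v. Q *v v)) x"
        using ae
      proof eventually_elim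
        case (elim x)
        then have "Q *v x \<noteq> 0" using n[of x] by auto
        then show ?case using elim by (simp add: f_def n matrix_vector_mult_scaleR)
      qed
    qed (use measurable_comp[OF f mS] measurable_comp[OF mU f] in auto)
    also have "\<dots> = distr (distr U U (\<lambda>v. Q *v v)) S f" by (rule distr_distr[OF f mU, symmetric])
    finally show ?thesis by (simp add: U)
  qed
  then have "rotation_invariant_sphere_prob ?\<sigma>"
    unfolding rotation_invariant_sphere_prob_def
    using U.prob_space_distr[OF f] by (auto simp: S_def)
  then show ?thesis ..
qed

(* The coefficients are indexed by multi-indices of total degree l; the zero polynomial counts
   as homogeneous of every degree. *)
definition homogeneous_polynomial :: "nat \<Rightarrow> (real ^ 'd \<Rightarrow> real) \<Rightarrow> bool" where
  "homogeneous_polynomial l P \<longleftrightarrow>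
     (\<exists>c :: ('d \<Rightarrow> nat) \<Rightarrow> real. \<forall>x.
        P x = (\<Sum>\<alpha> | (\<Sum>i\<in>UNIV. \<alpha> i) = l. c \<alpha> * (\<Prod>i\<in>UNIV. (x $ i) ^ \<alpha> i)))"

definition laplacian :: "(real ^ 'd \<Rightarrow> real) \<Rightarrow> real ^ 'd \<Rightarrow> real" where
  "laplacian f x = (\<Sum>i\<in>UNIV. (deriv ^^ 2) (\<lambda>t. f (x + t *\<^sub>R axis i 1)) 0)"

definition harmonic :: "(real ^ 'd \<Rightarrow> real) \<Rightarrow> bool" where
  "harmonic f \<longleftrightarrow> (\<forall>x. laplacian f x = 0)"

definition spherical_harmonics :: "nat \<Rightarrow> (real ^ 'd \<Rightarrow> real) set" where
  "spherical_harmonics l =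
     {restrict P (sphere 0 1) | P. homogeneous_polynomial l P \<and> harmonic P}"

definition is_funk_hecke_multiplier ::
    "(real ^ 'd) measure \<Rightarrow> (real \<Rightarrow> real) \<Rightarrow> nat \<Rightarrow> real \<Rightarrow> bool" where
  "is_funk_hecke_multiplier \<sigma> \<psi> l c \<longleftrightarrow>
     (\<forall>Y \<in> spherical_harmonics l. \<forall>u \<in> sphere 0 1.
        integrable \<sigma> (\<lambda>v. \<psi> (u \<bullet> v) * Y v) \<and>
        (\<integral>v. \<psi> (u \<bullet> v) * Y v \<partial>\<sigma>) = c * Y u)"

(* Meaningful only where the multiplier exists and is unique, e.g. it need not be unique when
   there are no nonzero spherical harmonics of degree l. *)
definition funk_hecke_multiplier ::
    "(real ^ 'd) measure \<Rightarrow> (real \<Rightarrow> real) \<Rightarrow> nat \<Rightarrow> real" where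
  "funk_hecke_multiplier \<sigma> \<psi> l = (THE c. is_funk_hecke_multiplier \<sigma> \<psi> l c)"

(* The case split is needed because 0 powr 0 = 0, whereas abs s to the power 0 is to be
   the constant 1.  For p < 0 the value at s = 0 is 0 instead of infinity; this concerns
   only a great subsphere, which is a null set. *)
definition abs_powr :: "real \<Rightarrow> real \<Rightarrow> real" where
  "abs_powr p s = (if p = 0 then 1 else \<bar>s\<bar> powr p)"

definition funk_hecke_const :: "nat \<Rightarrow> real \<Rightarrow> real" where
  "funk_hecke_const d p =
     Gamma (real d / 2) * Gamma ((p + 1) / 2) / (sqrt pi * Gamma ((real d + p) / 2))"

end

theory Submission
  imports Defs
begin

text \<open>Write \<open>I\<^sub>p[P](x) = \<integral> \<bar>\<langle>x, v\<rangle>\<bar>\<^sup>p P(v) d\<sigma>(v)\<close> for \<open>x \<noteq> 0\<close>, together with the variant in which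
  \<open>\<bar>s\<bar>\<^sup>p\<close> is replaced by the odd function \<open>sgn s \<bar>s\<bar>\<^sup>p\<close>. Differentiation in \<open>x\<close> lowers the exponent by one
  and exchanges the two parities. For a solid harmonic \<open>P\<close> of degree \<open>l\<close>, Euler's identity
  \<open>l P = \<Sum> v\<^sub>i \<partial>\<^sub>iP\<close> therefore expresses \<open>I\<^sub>p[P]\<close> as \<open>1 / (l (p + 1)) \<Sum> \<partial>\<^sub>i I\<^sub>p\<^sub>+\<^sub>1[\<partial>\<^sub>iP]\<close>. By induction
  \<open>I\<^sub>p\<^sub>+\<^sub>1[\<partial>\<^sub>iP]\<close> is a constant multiple of \<open>\<bar>x\<bar>\<^sup>p\<^sup>+\<^sup>2\<^sup>-\<^sup>l \<partial>\<^sub>iP(x)\<close>, and since \<open>\<Sum> \<partial>\<^sub>i\<partial>\<^sub>iP = 0\<close> the sum collapses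
  to a multiple of \<open>\<bar>x\<bar>\<^sup>p\<^sup>-\<^sup>l P(x)\<close>. So the multipliers satisfy
  \<open>\<lambda>\<^sub>l(p) = (p + 2 - l) / (p + 1) \<lambda>\<^sub>l\<^sub>-\<^sub>1(p + 1)\<close>, which reduces everything to \<open>l = 0\<close>: there the odd
  kernel integrates to \<open>0\<close>, and the even one is evaluated with a Gaussian weight.\<close>

subsection \<open>Solid harmonics\<close>

text \<open>Built from the one-variable \<open>deriv\<close> along a coordinate line, as in
  \<open>laplacian\<close>, so that iterated partials can be matched with the second derivatives
  there.\<close>

definition partial :: "'d \<Rightarrow> (real ^ 'd \<Rightarrow> real) \<Rightarrow> real ^ 'd \<Rightarrow> real" where
  "partial i f x = deriv (\<lambda>t. f (x + t *\<^sub>R axis i 1)) 0"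

text \<open>The derivative is given at every \<open>t\<close>, not only at 0: this identifies
  \<open>deriv\<close> of the restriction to a line as a function, which a second differentiation
  requires.\<close>

lemma has_real_derivative_line:
  fixes f :: "real ^ 'd \<Rightarrow> real"
  assumes "real_polynomial_function f"
  shows "((\<lambda>t. f (x + t *\<^sub>R axis i 1)) has_real_derivative partial i f (x + t *\<^sub>R axis i 1)) (at t)"
proof -
  have "f differentiable at (x + (t + 0) *\<^sub>R axis i 1)"
    using assms by (rule differentiable_at_real_polynomial_function)
  then obtain D where D: "(f has_derivative D) (at (x + t *\<^sub>R axis i 1))"
    by (auto simp: differentiable_def)
  \<comment> \<open>Base point and parameter stay free: the moved point with \<open>s = 0\<close>
    identifies \<open>D (axis i 1)\<close> as the partial, and base \<open>x\<close> with
    \<open>s = t\<close> gives the claim.\<close>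
  have *: "((\<lambda>s. f (y + s *\<^sub>R axis i 1)) has_real_derivative D (axis i 1)) (at s)"
    if "y + s *\<^sub>R axis i 1 = x + t *\<^sub>R axis i 1" for y s
  proof -
    have "((\<lambda>s. f (y + s *\<^sub>R axis i 1)) has_derivative (\<lambda>h. D (h *\<^sub>R axis i 1))) (at s)"
      by (rule has_derivative_compose[where g = f and f = "\<lambda>s. y + s *\<^sub>R axis i 1"])
        (auto intro!: derivative_eq_intros D simp: that)
    moreover have "linear D" using D by (rule has_derivative_linear)
    ultimately show ?thesis
      by (simp add: has_field_derivative_def linear_scale mult.commute[of _ "D _"])
  qed
  have "partial i f (x + t *\<^sub>R axis i 1) = D (axis i 1)"
    unfolding partial_def by (rule DERIV_imp_deriv[OF *]) simp
  then show ?thesis using *[OF refl] by simp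
qed

lemma has_real_derivative_partial:
  fixes f :: "real ^ 'd \<Rightarrow> real"
  assumes "real_polynomial_function f"
  shows "((\<lambda>t. f (x + t *\<^sub>R axis i 1)) has_real_derivative partial i f x) (at 0)"
  using has_real_derivative_line[OF assms, of x i 0] by simp

lemma partial_eqI:
  "((\<lambda>t. f (x + t *\<^sub>R axis i 1)) has_real_derivative D) (at 0) \<Longrightarrow> partial i f x = D"
  unfolding partial_def by (rule DERIV_imp_deriv)

lemma partial_const [simp]: "partial i (\<lambda>x. c) = (\<lambda>x. 0)"
  by (rule ext, rule partial_eqI) simp

lemma partial_linear: "bounded_linear f \<Longrightarrow> partial i f = (\<lambda>x. f (axis i 1))"
  by (rule ext, rule partial_eqI)
    (auto intro!: derivative_eq_intros simp: linear_simps)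

lemma partial_add:
  "real_polynomial_function f \<Longrightarrow> real_polynomial_function g \<Longrightarrow>
     partial i (\<lambda>x. f x + g x) = (\<lambda>x. partial i f x + partial i g x)"
  by (rule ext, rule partial_eqI) (intro DERIV_add has_real_derivative_partial)

lemma partial_mult:
  "real_polynomial_function f \<Longrightarrow> real_polynomial_function g \<Longrightarrow>
     partial i (\<lambda>x. f x * g x) = (\<lambda>x. partial i f x * g x + f x * partial i g x)"
  by (rule ext, rule partial_eqI)
    (auto intro!: derivative_eq_intros has_real_derivative_partial simp: algebra_simps)

lemma real_polynomial_function_partial:
  "real_polynomial_function f \<Longrightarrow> real_polynomial_function (partial i f)"
  by (induction rule: real_polynomial_function.induct)
    (auto simp: partial_linear partial_add partial_mult intro!: real_polynomial_function.intros(2-4))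

text \<open>Induction on the generation of polynomials: both mixed partials vanish on linear
  functions and constants, and the sum and product rules preserve the symmetry.\<close>

lemma partial_commute:
  "real_polynomial_function f \<Longrightarrow> partial i (partial j f) = partial j (partial i f)"
  by (induction rule: real_polynomial_function.induct)
    (auto simp: partial_linear partial_add partial_mult real_polynomial_function_partial real_polynomial_function.intros(4))

lemma partial_sum:
  "finite I \<Longrightarrow> (\<And>j. j \<in> I \<Longrightarrow> real_polynomial_function (f j)) \<Longrightarrow>
     partial i (\<lambda>x. \<Sum>j\<in>I. f j x) = (\<lambda>x. \<Sum>j\<in>I. partial i (f j) x)"
  by (induction I rule: finite_induct) (auto simp: partial_add real_polynomial_function_sum)

lemma has_derivative_partial:
  fixes f :: "real ^ 'd \<Rightarrow> real"
  assumes "real_polynomial_function f"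
  shows "(f has_derivative (\<lambda>h. \<Sum>i\<in>UNIV. h $ i * partial i f x)) (at x)"
proof -
  obtain D where D: "(f has_derivative D) (at x)"
    using differentiable_at_real_polynomial_function[OF assms] by (auto simp: differentiable_def)
  then have l: "linear D" by (rule has_derivative_linear)
  have "partial i f x = D (axis i 1)" for i
  proof (rule partial_eqI)
    have "((\<lambda>s. f (x + s *\<^sub>R axis i 1)) has_derivative (\<lambda>h. D (h *\<^sub>R axis i 1))) (at 0)"
      by (rule has_derivative_compose[where g = f and f = "\<lambda>s. x + s *\<^sub>R axis i 1"])
        (auto intro!: derivative_eq_intros D)
    then show "((\<lambda>t. f (x + t *\<^sub>R axis i 1)) has_real_derivative D (axis i 1)) (at 0)"
      using l by (simp add: has_field_derivative_def linear_scale mult.commute[of _ "D _"])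
  qed
  moreover have "D h = (\<Sum>i\<in>UNIV. h $ i * D (axis i 1))" for h
  proof -
    have "D h = D (\<Sum>i\<in>UNIV. h $ i *s axis i 1)" by (simp add: basis_expansion)
    then show ?thesis by (simp add: linear_sum[OF l] linear_scale[OF l] scalar_mult_eq_scaleR)
  qed
  ultimately show ?thesis using D by (metis (no_types, lifting) ext sum.cong)
qed

text \<open>Homogeneity is encoded as a scaling law for positive \<open>t\<close>, which can be
  differentiated directly, rather than through coefficients.\<close>

definition solid_harmonic :: "nat \<Rightarrow> (real ^ 'd \<Rightarrow> real) \<Rightarrow> bool" where
  "solid_harmonic l P \<longleftrightarrow> real_polynomial_function P \<and>
     (\<forall>t>0. \<forall>x. P (t *\<^sub>R x) = t ^ l * P x) \<and> (\<forall>x. (\<Sum>i\<in>UNIV. partial i (partial i P) x) = 0)"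

text \<open>Differentiating the scaling law lowers the degree by one, and the Laplacian commutes
  with partial derivatives. This lets the main induction run on the degree.\<close>

lemma solid_harmonic_partial:
  assumes "solid_harmonic (Suc l) P"
  shows "solid_harmonic l (partial i P)"
proof -
  have P: "real_polynomial_function P"
    and h: "\<And>t x. t > 0 \<Longrightarrow> P (t *\<^sub>R x) = t ^ Suc l * P x"
    and z: "\<And>x. (\<Sum>i\<in>UNIV. partial i (partial i P) x) = 0"
    using assms by (auto simp: solid_harmonic_def)
  have "partial i P (t *\<^sub>R x) = t ^ l * partial i P x" if t: "t > 0" for t x
  proof (rule partial_eqI)
    \<comment> \<open>Moving by \<open>s / t\<close> before scaling equals moving by
      \<open>s\<close> after scaling; the chain-rule factor \<open>1 / t\<close> removes one power
      of \<open>t\<close>.\<close>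
    have "((\<lambda>s. t ^ Suc l * P (x + (s / t) *\<^sub>R axis i 1)) has_real_derivative
        t ^ Suc l * (partial i P x * (1 / t))) (at 0)"
      by (intro DERIV_cmult DERIV_chain2[where f = "\<lambda>u. P (x + u *\<^sub>R axis i 1)"])
        (use t in \<open>auto intro!: derivative_eq_intros has_real_derivative_partial P\<close>)
    moreover have "t ^ Suc l * P (x + (s / t) *\<^sub>R axis i 1) = P (t *\<^sub>R x + s *\<^sub>R axis i 1)" for s
      using t by (subst h[symmetric]) (auto simp: scaleR_right_distrib)
    ultimately show "((\<lambda>s. P (t *\<^sub>R x + s *\<^sub>R axis i 1)) has_real_derivative t ^ l * partial i P x) (at 0)"
      using t by simp
  qed
  moreover have "(\<Sum>j\<in>UNIV. partial j (partial j (partial i P)) x) = 0" for x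
  proof -
    have "(\<Sum>j\<in>UNIV. partial j (partial j (partial i P)) x) = (\<Sum>j\<in>UNIV. partial i (partial j (partial j P)) x)"
      by (metis P partial_commute real_polynomial_function_partial)
    also have "\<dots> = partial i (\<lambda>x. \<Sum>j\<in>UNIV. partial j (partial j P) x) x"
      using P by (simp add: partial_sum real_polynomial_function_partial)
    finally show ?thesis by (simp add: z)
  qed
  ultimately show ?thesis
    using P by (auto simp: solid_harmonic_def real_polynomial_function_partial)
qed

text \<open>Differentiate \<open>P (t *\<^sub>R x)\<close> at \<open>t = 1\<close> in two ways, by
  the chain rule and by the scaling law.\<close>

lemma euler_solid_harmonic:
  assumes "solid_harmonic l P"
  shows "(\<Sum>i\<in>UNIV. x $ i * partial i P x) = real l * P x"
proof -
  have P: "real_polynomial_function P"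
    and h: "\<And>t x. t > 0 \<Longrightarrow> P (t *\<^sub>R x) = t ^ l * P x"
    using assms by (auto simp: solid_harmonic_def)
  have "((\<lambda>t. P (t *\<^sub>R x)) has_derivative (\<lambda>s. \<Sum>i\<in>UNIV. (s *\<^sub>R x) $ i * partial i P x)) (at 1)"
    by (rule has_derivative_compose[where g = P and f = "\<lambda>t. t *\<^sub>R x"])
      (use has_derivative_partial[OF P, of x] in \<open>auto intro!: derivative_eq_intros\<close>)
  then have "((\<lambda>t. P (t *\<^sub>R x)) has_real_derivative (\<Sum>i\<in>UNIV. x $ i * partial i P x)) (at 1)"
    by (simp add: has_field_derivative_def sum_distrib_left[symmetric] mult.assoc mult.commute[of _ "\<Sum>i\<in>_. _ i"])
  moreover have "((\<lambda>t. t ^ l * P x) has_real_derivative real l * P x) (at 1)"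
    by (auto intro!: derivative_eq_intros)
  then have "((\<lambda>t. P (t *\<^sub>R x)) has_real_derivative real l * P x) (at 1)"
    by (rule has_field_derivative_transform_within_open[where S = "{0<..}"]) (auto simp: h)
  ultimately show ?thesis by (rule DERIV_unique)
qed

text \<open>In degree 0 the function is constant along every open ray from the origin, and
  continuity at 0 ties all rays to the value there.\<close>

lemma solid_harmonic_0:
  assumes "solid_harmonic 0 P"
  shows "P x = P 0"
proof -
  have P: "real_polynomial_function P"
    and h: "\<And>t x. t > 0 \<Longrightarrow> P (t *\<^sub>R x) = P x"
    using assms by (auto simp: solid_harmonic_def)
  have "isCont P 0" using P by (simp add: continuous_real_polymonial_function)
  then have "((\<lambda>t. P (t *\<^sub>R x)) \<longlongrightarrow> P 0) (at_right 0)"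
    by (intro isCont_tendsto_compose[of 0 P]) (auto intro!: tendsto_eq_intros)
  moreover have "((\<lambda>t. P (t *\<^sub>R x)) \<longlongrightarrow> P x) (at_right 0)"
    by (rule tendsto_eventually) (auto simp: h eventually_at_right_less intro: eventually_mono[OF eventually_at_right_less[of 0]])
  ultimately show ?thesis by (metis tendsto_unique trivial_limit_at_right_real)
qed

lemma solid_harmonic_continuous: "solid_harmonic l P \<Longrightarrow> continuous_on A P"
  by (simp add: solid_harmonic_def continuous_at_imp_continuous_on continuous_real_polymonial_function)

text \<open>Each entry is bounded by the total degree. A sum over an infinite set would be 0 by
  convention; finiteness makes the sum in \<open>homogeneous_polynomial\<close> a genuine
  one.\<close>

lemma finite_multiindices: "finite {\<alpha> :: 'd :: finite \<Rightarrow> nat. (\<Sum>i\<in>UNIV. \<alpha> i) = l}"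
proof (rule finite_subset)
  show "{\<alpha>. (\<Sum>i\<in>UNIV. \<alpha> i) = l} \<subseteq> Pi\<^sub>E (UNIV :: 'd set) (\<lambda>_. {..l})"
    by (auto simp: PiE_def) (metis UNIV_I finite_class.finite_UNIV member_le_sum zero_le)
qed (auto intro!: finite_PiE)

text \<open>Bridge from the coefficient definition to the analytic one: the total degree of the
  monomials gives the scaling law, and the summands of \<open>laplacian\<close> are iterated
  partials.\<close>

lemma solid_harmonic_if_harmonic:
  assumes "homogeneous_polynomial l P" and "harmonic P"
  shows "solid_harmonic l P"
proof -
  obtain c where c: "\<And>x. P x = (\<Sum>\<alpha> | (\<Sum>i\<in>UNIV. \<alpha> i) = l. c \<alpha> * (\<Prod>i\<in>UNIV. (x $ i) ^ \<alpha> i))"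
    using assms(1) unfolding homogeneous_polynomial_def by blast
  have m: "real_polynomial_function (\<lambda>x :: real ^ 'd. \<Prod>i\<in>I. (x $ i) ^ \<alpha> i)" if "finite I" for I \<alpha>
    using that
    by induction (auto intro!: real_polynomial_function.intros(2-4) real_polynomial_function_power
        real_polynomial_function.intros(1)[OF bounded_linear_vec_nth])
  have P: "real_polynomial_function P"
    unfolding c[abs_def]
    by (intro real_polynomial_function_sum real_polynomial_function.intros(4) real_polynomial_function.intros(2) m)
      (simp_all add: finite_multiindices)
  have "P (t *\<^sub>R x) = t ^ l * P x" for t x
    unfolding c by (auto simp: power_mult_distrib prod.distrib sum_distrib_left mult_ac power_sum intro!: sum.cong)
  moreover have "partial i (partial i P) x = (deriv ^^ 2) (\<lambda>t. P (x + t *\<^sub>R axis i 1)) 0" for i x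
  proof -
    have "deriv (\<lambda>t. P (x + t *\<^sub>R axis i 1)) = (\<lambda>t. partial i P (x + t *\<^sub>R axis i 1))"
      by (rule ext, rule DERIV_imp_deriv, rule has_real_derivative_line[OF P])
    then show ?thesis by (simp add: partial_def[of i "partial i P"] numeral_2_eq_2)
  qed
  ultimately show ?thesis
    using P assms(2) by (simp add: solid_harmonic_def harmonic_def laplacian_def)
qed

section \<open>Existence of nonzero spherical harmonics in every degree\<close>

lemma homogeneous_polynomial_lincomb:
  assumes "homogeneous_polynomial l P" "homogeneous_polynomial l R"
  shows "homogeneous_polynomial l (\<lambda>x. a * P x + b * R x)"
proof -
  obtain c e where "\<And>x. P x = (\<Sum>\<alpha> | (\<Sum>i\<in>UNIV. \<alpha> i) = l. c \<alpha> * (\<Prod>i\<in>UNIV. (x $ i) ^ \<alpha> i))"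
    "\<And>x. R x = (\<Sum>\<alpha> | (\<Sum>i\<in>UNIV. \<alpha> i) = l. e \<alpha> * (\<Prod>i\<in>UNIV. (x $ i) ^ \<alpha> i))"
    using assms unfolding homogeneous_polynomial_def by blast
  then show ?thesis unfolding homogeneous_polynomial_def
    by (intro exI[of _ "\<lambda>\<alpha>. a * c \<alpha> + b * e \<alpha>"])
      (simp add: sum_distrib_left sum.distrib algebra_simps)
qed

text \<open>Raising the exponent at \<open>k\<close> maps the multi-indices of degree
  \<open>l\<close> bijectively onto those of degree \<open>Suc l\<close> with nonzero entry at
  \<open>k\<close>; the remaining ones receive coefficient 0.\<close>

lemma homogeneous_polynomial_coordinate_mult:
  fixes P :: "real ^ 'd \<Rightarrow> real"
  assumes "homogeneous_polynomial l P"
  shows "homogeneous_polynomial (Suc l) (\<lambda>x. x $ k * P x)"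
proof -
  obtain c where c: "\<And>x. P x = (\<Sum>\<alpha> | (\<Sum>i\<in>UNIV. \<alpha> i) = l. c \<alpha> * (\<Prod>i\<in>UNIV. (x $ i) ^ \<alpha> i))"
    using assms unfolding homogeneous_polynomial_def by blast
  define up where "up \<alpha> = \<alpha>(k := Suc (\<alpha> k))" for \<alpha> :: "'d \<Rightarrow> nat"
  define c' where "c' \<alpha> = (if \<alpha> k = 0 then 0 else c (\<alpha>(k := \<alpha> k - 1)))" for \<alpha>
  \<comment> \<open>Stated with additions on both sides because subtraction on \<open>nat\<close>
    truncates.\<close>
  have sum_upd: "(\<Sum>i\<in>UNIV. (\<alpha>(k := m)) i) + \<alpha> k = (\<Sum>i\<in>UNIV. \<alpha> i) + m" for \<alpha> :: "'d \<Rightarrow> nat" and m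
    by (simp add: sum.remove[of UNIV k])
  have up: "bij_betw up {\<alpha>. (\<Sum>i\<in>UNIV. \<alpha> i) = l} {\<alpha>. (\<Sum>i\<in>UNIV. \<alpha> i) = Suc l \<and> \<alpha> k \<noteq> 0}"
  proof (rule bij_betwI[where g = "\<lambda>\<alpha>. \<alpha>(k := \<alpha> k - 1)"])
    show "up \<in> {\<alpha>. (\<Sum>i\<in>UNIV. \<alpha> i) = l} \<rightarrow> {\<alpha>. (\<Sum>i\<in>UNIV. \<alpha> i) = Suc l \<and> \<alpha> k \<noteq> 0}"
    proof clarify
      fix \<alpha> :: "'d \<Rightarrow> nat"
      show "(\<Sum>i\<in>UNIV. up \<alpha> i) = Suc (\<Sum>i\<in>UNIV. \<alpha> i) \<and> up \<alpha> k \<noteq> 0"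
        using sum_upd[of \<alpha> "Suc (\<alpha> k)"] by (simp add: up_def)
    qed
    show "(\<lambda>\<alpha>. \<alpha>(k := \<alpha> k - 1)) \<in> {\<alpha>. (\<Sum>i\<in>UNIV. \<alpha> i) = Suc l \<and> \<alpha> k \<noteq> 0} \<rightarrow> {\<alpha>. (\<Sum>i\<in>UNIV. \<alpha> i) = l}"
    proof clarify
      fix \<alpha> :: "'d \<Rightarrow> nat" assume "(\<Sum>i\<in>UNIV. \<alpha> i) = Suc l" "0 < \<alpha> k"
      then show "(\<Sum>i\<in>UNIV. (\<alpha>(k := \<alpha> k - 1)) i) = l" using sum_upd[of \<alpha> "\<alpha> k - 1"] by linarith
    qed
  qed (auto simp: up_def)
  have mon: "(\<Prod>i\<in>UNIV. (x $ i) ^ up \<alpha> i) = x $ k * (\<Prod>i\<in>UNIV. (x $ i) ^ \<alpha> i)" for x :: "real ^ 'd" and \<alpha>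
    by (simp add: prod.remove[of UNIV k] up_def)
  have "x $ k * P x = (\<Sum>\<alpha> | (\<Sum>i\<in>UNIV. \<alpha> i) = Suc l. c' \<alpha> * (\<Prod>i\<in>UNIV. (x $ i) ^ \<alpha> i))" for x
  proof -
    have "x $ k * P x = (\<Sum>\<alpha> | (\<Sum>i\<in>UNIV. \<alpha> i) = l. c' (up \<alpha>) * (\<Prod>i\<in>UNIV. (x $ i) ^ up \<alpha> i))"
      unfolding mon by (auto simp: c sum_distrib_left c'_def up_def mult_ac intro!: sum.cong)
    also have "\<dots> = (\<Sum>\<alpha> | (\<Sum>i\<in>UNIV. \<alpha> i) = Suc l \<and> \<alpha> k \<noteq> 0. c' \<alpha> * (\<Prod>i\<in>UNIV. (x $ i) ^ \<alpha> i))"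
      by (rule sum.reindex_bij_betw[OF up])
    also have "\<dots> = (\<Sum>\<alpha> | (\<Sum>i\<in>UNIV. \<alpha> i) = Suc l. c' \<alpha> * (\<Prod>i\<in>UNIV. (x $ i) ^ \<alpha> i))"
      by (rule sum.mono_neutral_left) (auto simp: finite_multiindices c'_def)
    finally show ?thesis .
  qed
  then show ?thesis unfolding homogeneous_polynomial_def by blast
qed

text \<open>Multiplication by \<open>z x\<close> mixes real and imaginary parts, so both go through
  one induction.\<close>

lemma homogeneous_polynomial_complex_power:
  fixes a b :: "'d::finite"
  defines "z \<equiv> \<lambda>x :: real ^ 'd. Complex (x $ a) (x $ b)"
  shows "homogeneous_polynomial l (\<lambda>x. Re (z x ^ l))" and "homogeneous_polynomial l (\<lambda>x. Im (z x ^ l))"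
proof (induction l)
  case 0
  have "{\<alpha> :: 'd \<Rightarrow> nat. (\<Sum>i\<in>UNIV. \<alpha> i) = 0} = {\<lambda>_. 0}" by auto
  then have "homogeneous_polynomial 0 (\<lambda>x :: real ^ 'd. r)" for r
    unfolding homogeneous_polynomial_def by (intro exI[of _ "\<lambda>_. r"]) simp
  from this[of 1] this[of 0] show "homogeneous_polynomial 0 (\<lambda>x. Re (z x ^ 0))" "homogeneous_polynomial 0 (\<lambda>x. Im (z x ^ 0))"
    by simp_all
next
  case (Suc l)
  note * = homogeneous_polynomial_coordinate_mult[OF Suc(1)] homogeneous_polynomial_coordinate_mult[OF Suc(2)]
  show "homogeneous_polynomial (Suc l) (\<lambda>x. Re (z x ^ Suc l))"
    using homogeneous_polynomial_lincomb[OF *(1)[of a] *(2)[of b], of 1 "-1"] by (simp add: z_def)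
  show "homogeneous_polynomial (Suc l) (\<lambda>x. Im (z x ^ Suc l))"
    using homogeneous_polynomial_lincomb[OF *(2)[of a] *(1)[of b], of 1 1] by (simp add: z_def)
qed

text \<open>The witness is the real part of the \<open>l\<close>-th power of
  \<open>Complex (x $ a) (x $ b)\<close>. It is harmonic because the squared directions 1 and
  \<open>\<i>\<close> add up to 0. A nonzero value is what makes multipliers unique.\<close>

lemma nonzero_spherical_harmonic_exists:
  assumes "CARD('d) \<ge> 2"
  obtains Y and u :: "real ^ 'd" where "Y \<in> spherical_harmonics l" "u \<in> sphere 0 1" "Y u \<noteq> 0"
proof -
  obtain a b :: 'd where ab: "a \<noteq> b"
    using assms by (metis UNIV_I card_2_iff' card_le_Suc0_iff_eq finite_class.finite_UNIV not_less_eq_eq numeral_2_eq_2)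
  define P where "P x = Re (Complex (x $ a) (x $ b) ^ l)" for x :: "real ^ 'd"
  have hom: "homogeneous_polynomial l P"
    unfolding P_def by (rule homogeneous_polynomial_complex_power)
  \<comment> \<open>For \<open>l < 2\<close> the exponent \<open>l - 2\<close> truncates, but then
    the factor \<open>l * (l - 1)\<close> is 0.\<close>
  have D2: "(deriv ^^ 2) (\<lambda>t. Re ((z + of_real t * w) ^ l)) 0 = Re (w\<^sup>2 * (of_nat (l * (l - 1)) * z ^ (l - 2)))" for z w :: complex
  proof -
    have d: "((\<lambda>t. Re (c * (z + of_real t * w) ^ m)) has_real_derivative
        Re (c * w * of_nat m * (z + of_real t * w) ^ (m - 1))) (at t)" for c m t
    proof -
      have "((\<lambda>\<zeta>. c * (z + \<zeta> * w) ^ m) has_field_derivative c * w * of_nat m * (z + of_real t * w) ^ (m - 1)) (at (of_real t))"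
        by (auto intro!: derivative_eq_intros)
      from has_field_derivative_Re[OF field_vector_diff_chain_at[OF has_vector_derivative_of_real[OF DERIV_ident] this]]
      show ?thesis by (simp add: o_def has_real_derivative_iff_has_vector_derivative)
    qed
    have "deriv (\<lambda>t. Re ((z + of_real t * w) ^ l)) = (\<lambda>t. Re (w * of_nat l * (z + of_real t * w) ^ (l - 1)))"
      using d[of 1 l] by (intro ext DERIV_imp_deriv) simp
    then show ?thesis
      using DERIV_imp_deriv[OF d[of "w * of_nat l" "l - 1" 0]]
      by (simp add: numeral_2_eq_2 mult_ac)
  qed
  have "laplacian P x = 0" for x
  proof -
    define z where "z = Complex (x $ a) (x $ b)"
    \<comment> \<open>\<open>w i\<close> is the direction in which \<open>z\<close> moves when
      \<open>x\<close> moves along axis \<open>i\<close>.\<close>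
    define w where "w i = (if i = a then 1 else if i = b then \<i> else 0)" for i
    have "P (x + t *\<^sub>R axis i 1) = Re ((z + of_real t * w i) ^ l)" for t i
      unfolding P_def
      by (rule arg_cong[where f = "\<lambda>z. Re (z ^ l)"])
        (use ab in \<open>auto simp: z_def w_def complex_eq_iff axis_def\<close>)
    then have "laplacian P x = (\<Sum>i\<in>UNIV. Re ((w i)\<^sup>2 * (of_nat (l * (l - 1)) * z ^ (l - 2))))"
      by (simp add: laplacian_def D2)
    also have "\<dots> = Re ((\<Sum>i\<in>UNIV. (w i)\<^sup>2) * (of_nat (l * (l - 1)) * z ^ (l - 2)))"
      by (simp only: sum_distrib_right Re_sum)
    also have "(\<Sum>i\<in>UNIV. (w i)\<^sup>2) = (\<Sum>i\<in>{a, b}. (w i)\<^sup>2)"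
      by (rule sum.mono_neutral_right) (auto simp: w_def)
    also have "\<dots> = 0" using ab by (simp add: w_def)
    finally show ?thesis by simp
  qed
  then have Y: "restrict P (sphere 0 1) \<in> spherical_harmonics l"
    using hom by (auto simp: spherical_harmonics_def harmonic_def)
  have "P (axis a 1) = 1" using ab by (simp add: P_def axis_def flip: one_complex.code)
  then show thesis
    using that[OF Y, of "axis a 1"] by simp
qed

subsection \<open>Gaussian moments\<close>

text \<open>Polar coordinates for radial functions. On half-lines both sides give the volume of a
  ball, whose derivative in the radius is the density; the half-lines form an intersection-stable
  generator.\<close>

lemma distr_norm_lborel:
  "distr lborel borel (norm :: 'a :: euclidean_space \<Rightarrow> real) =
     density lborel (\<lambda>r. ennreal (real DIM('a) * unit_ball_vol DIM('a) * r ^ (DIM('a) - 1)) * indicator {0..} r)"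
    (is "?L = density _ ?f")
proof (rule measure_eqI_generator_eq[where \<Omega> = UNIV and E = "range atMost" and A = "\<lambda>i. {.. real i}"])
  let ?n = "DIM('a)" and ?V = "unit_ball_vol DIM('a)"
  have [measurable]: "?f \<in> borel_measurable lborel" by measurable
  show "emeasure ?L X = emeasure (density lborel ?f) X" if "X \<in> range atMost" for X
  proof -
    obtain a where X: "X = {..a}" using \<open>X \<in> _\<close> by auto
    have L: "emeasure ?L X = emeasure lborel (cball (0::'a) a)"
      unfolding X by (subst emeasure_distr) (auto simp: vimage_def intro!: arg_cong[where f = "emeasure lborel"])
    have R: "emeasure (density lborel ?f) X = (\<integral>\<^sup>+r. ?f r * indicator X r \<partial>lborel)"
      unfolding X by (subst emeasure_density) auto
    show ?thesis
    proof (cases "a < 0")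
      case True
      then have z: "?f r * indicator X r = 0" for r by (auto simp: X indicator_def)
      have "emeasure (density lborel ?f) X = 0" unfolding R z by simp
      then show ?thesis using True by (simp add: L)
    next
      case False
      have "(\<integral>\<^sup>+r. ?f r * indicator X r \<partial>lborel) =
          (\<integral>\<^sup>+r. ennreal (real ?n * ?V * r ^ (?n - 1)) * indicator {0..a} r \<partial>lborel)"
        by (intro nn_integral_cong) (auto simp: X indicator_def)
      also have "\<dots> = ennreal (?V * a ^ ?n - ?V * 0 ^ ?n)"
        by (rule nn_integral_FTC_Icc) (use False in \<open>auto intro!: derivative_eq_intros mult_nonneg_nonneg unit_ball_vol_nonneg\<close>)
      finally show ?thesis using False unfolding L R by (simp add: emeasure_cball)
    qed
  qed
  show "emeasure ?L {..real i} \<noteq> \<infinity>" for i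
  proof -
    have "emeasure ?L {..real i} = emeasure lborel (cball (0::'a) (real i))"
      by (subst emeasure_distr) (auto simp: vimage_def intro!: arg_cong[where f = "emeasure lborel"])
    then show ?thesis by (simp add: emeasure_cball)
  qed
  show "(\<Union>i. {..real i}) = UNIV" using real_arch_simple by auto
  show "Int_stable (range (atMost :: real \<Rightarrow> _))"
    by (auto simp: Int_stable_def intro!: range_eqI[where x = "min _ _"])
qed (auto simp: borel_eq_atMost sets_measure_of)

text \<open>Substitution of \<open>r\<^sup>2\<close> for \<open>t\<close> in Euler's integral for
  Gamma at \<open>a / 2\<close>.\<close>

lemma nn_integral_powr_exp_square_pos:
  assumes "a > 0"
  shows "(\<integral>\<^sup>+r. ennreal (r powr (a - 1) * exp (- r\<^sup>2)) * indicator {0<..} r \<partial>lborel) =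
     ennreal (Gamma (a / 2) / 2)"
proof -
  have sq: "(\<lambda>r::real. r\<^sup>2) ` {0<..} = {0<..}"
  proof safe
    fix t :: real assume "t > 0"
    then show "t \<in> (\<lambda>r. r\<^sup>2) ` {0<..}" by (intro image_eqI[of _ _ "sqrt t"]) auto
  qed auto
  have "((\<lambda>t. t powr (a / 2 - 1) / exp t) has_integral Gamma (a / 2)) {0<..}"
    using Gamma_integral_real[of "a / 2"] assms
    by (subst has_integral_spike_set_eq[of _ "{0..}"])
      (auto intro: negligible_subset[OF negligible_sing[of "0 :: real"]])
  then have I: "(\<lambda>t. t powr (a / 2 - 1) / exp t) integrable_on {0<..}"
    "integral {0<..} (\<lambda>t. t powr (a / 2 - 1) / exp t) = Gamma (a / 2)"
    by (rule has_integral_integrable, rule integral_unique)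
  from I(1) have "(\<lambda>t. t powr (a / 2 - 1) / exp t) absolutely_integrable_on {0<..}"
    by (rule nonnegative_absolutely_integrable_1) simp
  with I(2) sq have K: "(\<lambda>t. t powr (a / 2 - 1) / exp t) absolutely_integrable_on (\<lambda>r. r\<^sup>2) ` {0<..} \<and>
      integral ((\<lambda>r. r\<^sup>2) ` {0<..}) (\<lambda>t. t powr (a / 2 - 1) / exp t) = Gamma (a / 2)"
    by simp
  have J: "(\<lambda>r. \<bar>2 * r\<bar> * (r\<^sup>2 powr (a / 2 - 1) / exp (r\<^sup>2))) absolutely_integrable_on {0<..} \<and>
      integral {0<..} (\<lambda>r. \<bar>2 * r\<bar> * (r\<^sup>2 powr (a / 2 - 1) / exp (r\<^sup>2))) = Gamma (a / 2)"
  proof -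
    have der: "((\<lambda>r. r\<^sup>2) has_field_derivative 2 * r) (at r within {0<..})" for r :: real
      by (auto intro!: derivative_eq_intros)
    have inj: "inj_on (\<lambda>r :: real. r\<^sup>2) {0<..}"
      by (rule inj_onI) (simp add: power2_eq_iff_nonneg)
    have "{0 :: real<..} \<in> sets lebesgue" by simp
    from has_absolute_integral_change_of_variables_1'[where f = "\<lambda>t. t powr (a / 2 - 1) / exp t"
          and b = "Gamma (a / 2)", OF this der inj] K
    show ?thesis by (rule iffD2)
  qed
  have "((\<lambda>r. \<bar>2 * r\<bar> * (r\<^sup>2 powr (a / 2 - 1) / exp (r\<^sup>2))) has_integral Gamma (a / 2)) {0<..}"
    using integrable_integral[OF set_lebesgue_integral_eq_integral(1)[OF conjunct1[OF J]]]
    unfolding conjunct2[OF J] .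
  then have "((\<lambda>r. \<bar>2 * r\<bar> * (r\<^sup>2 powr (a / 2 - 1) / exp (r\<^sup>2)) / 2) has_integral Gamma (a / 2) / 2) {0<..}"
    by (rule has_integral_divide)
  then have "((\<lambda>r. r powr (a - 1) * exp (- r\<^sup>2)) has_integral Gamma (a / 2) / 2) {0<..}"
  proof (rule has_integral_eq[rotated])
    fix r :: real assume "r \<in> {0<..}"
    then have r: "r > 0" by simp
    have "r\<^sup>2 powr (a / 2 - 1) = r powr (2 * (a / 2 - 1))"
      using powr_powr[of r 2 "a / 2 - 1"] powr_numeral[of r "num.Bit0 num.One"] r by (simp only: less_imp_le)
    \<comment> \<open>The Jacobian contributes one further power of \<open>r\<close>: 1 + 2(a/2 - 1)
      = a - 1.\<close>
    moreover have "r powr 1 * r powr (2 * (a / 2 - 1)) = r powr (a - 1)"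
      unfolding powr_add[symmetric] by (rule arg_cong[where f = "(powr) r"]) simp
    ultimately have *: "r * r\<^sup>2 powr (a / 2 - 1) = r powr (a - 1)"
      using powr_one[of r] r by (simp only: less_imp_le)
    have "\<bar>2 * r\<bar> * (r\<^sup>2 powr (a / 2 - 1) / exp (r\<^sup>2)) / 2 = (r * r\<^sup>2 powr (a / 2 - 1)) / exp (r\<^sup>2)"
      using r by simp
    also have "\<dots> = r powr (a - 1) * exp (- r\<^sup>2)"
      unfolding * exp_minus by (rule divide_inverse)
    finally show "\<bar>2 * r\<bar> * (r\<^sup>2 powr (a / 2 - 1) / exp (r\<^sup>2)) / 2 = r powr (a - 1) * exp (- r\<^sup>2)" .
  qed
  then show ?thesis by (rule nn_integral_has_integral_lebesgue'[rotated]) simp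
qed

lemma abs_powr_nonneg: "0 \<le> abs_powr p s"
  by (simp add: abs_powr_def)

lemma abs_powr_measurable [measurable]: "abs_powr p \<in> borel_measurable borel"
  unfolding abs_powr_def[abs_def] by measurable

lemma abs_powr_eq_powr: "s > 0 \<Longrightarrow> abs_powr p s = s powr p"
  by (simp add: abs_powr_def)

text \<open>The integrand is even, so the half-line integral is doubled; the origin is a null
  set.\<close>

lemma nn_integral_abs_powr_exp_square:
  assumes "p > -1"
  shows "(\<integral>\<^sup>+s. ennreal (abs_powr p s * exp (- s\<^sup>2)) \<partial>lborel) = ennreal (Gamma ((p + 1) / 2))"
proof -
  let ?f = "\<lambda>s. ennreal (abs_powr p s * exp (- s\<^sup>2))"
  have pos: "(\<integral>\<^sup>+s. ?f s * indicator {0<..} s \<partial>lborel) = ennreal (Gamma ((p + 1) / 2) / 2)"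
  proof -
    have "?f s * indicator {0<..} s = ennreal (s powr (p + 1 - 1) * exp (- s\<^sup>2)) * indicator {0<..} s" for s
      by (auto simp: indicator_def abs_powr_eq_powr)
    then show ?thesis using nn_integral_powr_exp_square_pos[of "p + 1"] assms by simp
  qed
  have "(\<integral>\<^sup>+s. ?f s * indicator {..<0} s \<partial>lborel) =
      (\<integral>\<^sup>+s. ?f s * indicator {..<0} s \<partial>distr lborel borel uminus)"
    by (simp add: lborel_distr_uminus)
  also have "\<dots> = (\<integral>\<^sup>+s. ?f s * indicator {0<..} s \<partial>lborel)"
    by (subst nn_integral_distr) (auto intro!: nn_integral_cong simp: indicator_def abs_powr_def)
  finally have neg: "(\<integral>\<^sup>+s. ?f s * indicator {..<0} s \<partial>lborel) = ennreal (Gamma ((p + 1) / 2) / 2)"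
    by (simp add: pos)
  have "(\<integral>\<^sup>+s. ?f s \<partial>lborel) = (\<integral>\<^sup>+s. ?f s * indicator {0<..} s + ?f s * indicator {..<0} s \<partial>lborel)"
    by (rule nn_integral_cong_AE, rule eventually_mono[OF AE_lborel_singleton[of 0]])
      (auto simp: indicator_def)
  also have "\<dots> = ennreal (Gamma ((p + 1) / 2) / 2) + ennreal (Gamma ((p + 1) / 2) / 2)"
    by (subst nn_integral_add) (auto simp: pos neg)
  also have "\<dots> = ennreal (Gamma ((p + 1) / 2))"
    using assms by (subst ennreal_plus[symmetric]) (auto intro!: divide_nonneg_pos Gamma_real_nonneg)
  finally show ?thesis .
qed

text \<open>In polar coordinates the density exponent \<open>DIM('a) - 1\<close> and
  \<open>p\<close> add up, which leaves a half-line Gamma integral.\<close>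

lemma nn_integral_abs_powr_norm_exp_square:
  assumes "p > - real DIM('a :: euclidean_space)"
  shows "(\<integral>\<^sup>+(x :: 'a). ennreal (abs_powr p (norm x) * exp (- (norm x)\<^sup>2)) \<partial>lborel) =
     ennreal (real DIM('a) * unit_ball_vol DIM('a) / 2 * Gamma ((real DIM('a) + p) / 2))"
proof -
  let ?n = "DIM('a)"
  let ?c = "real DIM('a) * unit_ball_vol DIM('a)"
  have c: "?c \<ge> 0" by (simp add: unit_ball_vol_nonneg)
  have "(\<integral>\<^sup>+(x::'a). ennreal (abs_powr p (norm x) * exp (- (norm x)\<^sup>2)) \<partial>lborel) =
      (\<integral>\<^sup>+r. ennreal (abs_powr p r * exp (- r\<^sup>2)) \<partial>distr lborel borel (norm :: 'a \<Rightarrow> real))"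
    by (subst nn_integral_distr) auto
  also have "\<dots> = (\<integral>\<^sup>+r. ennreal (?c * r ^ (?n - 1)) * indicator {0..} r * ennreal (abs_powr p r * exp (- r\<^sup>2)) \<partial>lborel)"
    unfolding distr_norm_lborel by (subst nn_integral_density) auto
  also have "\<dots> = (\<integral>\<^sup>+r. ennreal ?c * (ennreal (r powr (real ?n + p - 1) * exp (- r\<^sup>2)) * indicator {0<..} r) \<partial>lborel)"
  \<comment> \<open>The integrands may differ at \<open>r = 0\<close>, which is a null set.\<close>
  proof (rule nn_integral_cong_AE, rule eventually_mono[OF AE_lborel_singleton[of 0]])
    fix r :: real assume "r \<noteq> 0"
    show "ennreal (?c * r ^ (?n - 1)) * indicator {0..} r * ennreal (abs_powr p r * exp (- r\<^sup>2)) =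
        ennreal ?c * (ennreal (r powr (real ?n + p - 1) * exp (- r\<^sup>2)) * indicator {0<..} r)"
    proof (cases "r > 0")
      case True
      have "r ^ (?n - 1) * abs_powr p r = r powr (real ?n + p - 1)"
      proof -
        have "real (?n - 1) = real ?n - 1" by (simp add: of_nat_diff Suc_leI)
        then have "r ^ (?n - 1) * abs_powr p r = r powr (real ?n - 1) * r powr p"
          using True powr_realpow[of r "?n - 1"] by (simp add: abs_powr_eq_powr)
        also have "\<dots> = r powr (real ?n + p - 1)"
          by (subst powr_add[symmetric]) (simp add: algebra_simps)
        finally show ?thesis .
      qed
      then have *: "?c * r ^ (?n - 1) * (abs_powr p r * exp (- r\<^sup>2)) = ?c * (r powr (real ?n + p - 1) * exp (- r\<^sup>2))"
        by (simp only: mult.assoc[symmetric]) (simp only: mult.assoc)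
      have "ennreal (?c * r ^ (?n - 1)) * indicator {0..} r * ennreal (abs_powr p r * exp (- r\<^sup>2)) =
          ennreal (?c * r ^ (?n - 1) * (abs_powr p r * exp (- r\<^sup>2)))"
        using True c by (subst ennreal_mult') auto
      also have "\<dots> = ennreal ?c * (ennreal (r powr (real ?n + p - 1) * exp (- r\<^sup>2)) * indicator {0<..} r)"
        unfolding * using True c by (subst ennreal_mult') auto
      finally show ?thesis .
    qed (use \<open>r \<noteq> 0\<close> in auto)
  qed
  also have "\<dots> = ennreal ?c * ennreal (Gamma ((real ?n + p) / 2) / 2)"
    using assms by (subst nn_integral_cmult) (auto simp: nn_integral_powr_exp_square_pos)
  also have "\<dots> = ennreal (?c / 2 * Gamma ((real ?n + p) / 2))"
    using c by (subst ennreal_mult'[symmetric]) (auto simp: mult_ac)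
  finally show ?thesis .
qed

text \<open>The Gaussian factors over coordinates: the one along \<open>e\<close> carries the power,
  and each of the others is the case \<open>p = 0\<close> with value \<open>sqrt pi\<close>.\<close>

lemma nn_integral_abs_powr_inner_exp_square:
  assumes "p > -1" and e: "e \<in> (Basis :: 'a :: euclidean_space set)"
  shows "(\<integral>\<^sup>+x. ennreal (abs_powr p (x \<bullet> e) * exp (- (norm x)\<^sup>2)) \<partial>lborel) =
     ennreal (Gamma ((p + 1) / 2) * sqrt pi ^ (DIM('a) - 1))"
proof -
  define f where "f b s = (if b = e then abs_powr p s else 1) * exp (- s\<^sup>2)" for b :: 'a and s
  have [measurable]: "f b \<in> borel_measurable borel" for b unfolding f_def[abs_def] by measurable
  have nn: "0 \<le> f b s" for b s by (simp add: f_def abs_powr_nonneg)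
  have f: "(\<Prod>b\<in>Basis. f b (x \<bullet> b)) = abs_powr p (x \<bullet> e) * exp (- (norm x)\<^sup>2)" for x :: 'a
  proof -
    have "(norm x)\<^sup>2 = (\<Sum>b\<in>Basis. (x \<bullet> b)\<^sup>2)"
      by (simp add: norm_eq_sqrt_inner euclidean_inner[of x x] power2_eq_square sum_nonneg)
    then show ?thesis
      using e by (simp add: f_def prod.distrib sum_negf[symmetric] exp_sum)
  qed
  have "(\<integral>\<^sup>+x. ennreal (abs_powr p (x \<bullet> e) * exp (- (norm x)\<^sup>2)) \<partial>lborel) =
      (\<integral>\<^sup>+x. (\<Prod>b\<in>Basis. ennreal (f b (x \<bullet> b))) \<partial>lborel)"
    by (simp add: f[symmetric] prod_ennreal nn)
  also have "\<dots> = (\<Prod>b\<in>Basis. \<integral>\<^sup>+s. ennreal (f b s) \<partial>lborel)"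
    by (rule nn_integral_lborel_prod) auto
  also have "\<dots> = (\<Prod>b\<in>Basis. ennreal (if b = e then Gamma ((p + 1) / 2) else sqrt pi))"
    using nn_integral_abs_powr_exp_square[OF assms(1)] nn_integral_abs_powr_exp_square[of 0]
    by (intro prod.cong) (auto simp: f_def abs_powr_def Gamma_one_half_real)
  also have "\<dots> = ennreal (Gamma ((p + 1) / 2) * sqrt pi ^ (DIM('a) - 1))"
    using assms by (subst prod_ennreal) (auto intro!: Gamma_real_nonneg simp: prod.remove[OF _ e] card_Diff_singleton)
  finally show ?thesis .
qed

subsection \<open>Rotations and signed powers\<close>

lemma continuous_on_matrix_vector_mult:
  "continuous_on S (\<lambda>Q :: real ^ 'n ^ 'm. Q *v v)"
  unfolding matrix_vector_mult_def by (intro continuous_intros)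

lemma borel_measurable_matrix_vector_mult [measurable]:
  "(\<lambda>v. Q *v v) \<in> borel_measurable (borel :: (real ^ 'n) measure)" for Q :: "real ^ 'n ^ 'm"
  by (intro borel_measurable_continuous_onI linear_continuous_on matrix_vector_mul_bounded_linear)

lemma rotation_matrix_inner:
  assumes "rotation_matrix Q"
  shows "(Q *v x) \<bullet> (Q *v y) = x \<bullet> (y :: real ^ 'n)"
proof -
  have "orthogonal_transformation (\<lambda>v. Q *v v)"
    using assms by (simp add: orthogonal_transformation_matrix rotation_matrix_def)
  then show ?thesis by (simp add: orthogonal_transformation_def)
qed

lemma rotation_matrix_norm:
  "rotation_matrix Q \<Longrightarrow> norm (Q *v x) = norm (x :: real ^ 'n)"
  by (simp add: norm_eq_sqrt_inner rotation_matrix_inner)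

text \<open>Rotations act transitively on spheres about the origin; in dimension 1 the only rotation
  is the identity, hence the bound on the dimension.\<close>

lemma rotation_matrix_between:
  fixes x y :: "real ^ 'd"
  assumes "2 \<le> CARD('d)" "norm x = norm y"
  obtains Q where "rotation_matrix Q" "Q *v x = y"
proof -
  obtain f where f: "orthogonal_transformation f" "det (matrix f) = 1" "f x = y"
    using rotation_exists[OF assms] by blast
  then have "rotation_matrix (matrix f)" "matrix f *v x = y"
    by (auto simp: rotation_matrix_def orthogonal_transformation_matrix matrix_works orthogonal_transformation_linear)
  then show thesis by (rule that)
qed

text \<open>Rows are unit vectors, which gives boundedness, and the defining equations are
  polynomial in the entries, which gives closedness. Compactness later carries continuity from the
  group to the sphere.\<close>

lemma compact_rotation_matrices:
  "compact {Q :: real ^ 'n ^ 'n. rotation_matrix Q}"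
proof (rule compact_eq_bounded_closed[THEN iffD2, OF conjI])
  have "norm Q \<le> real CARD('n)" if "rotation_matrix Q" for Q :: "real ^ 'n ^ 'n"
  proof -
    have "norm (Q $ i) = 1" for i
      using that by (simp add: rotation_matrix_def orthogonal_matrix_orthonormal_rows row_def)
    moreover have "norm Q \<le> (\<Sum>i\<in>UNIV. norm (Q $ i))"
      unfolding norm_vec_def[of Q] by (rule L2_set_le_sum) simp
    ultimately show ?thesis by simp
  qed
  then show "bounded {Q :: real ^ 'n ^ 'n. rotation_matrix Q}"
    by (auto simp: bounded_iff)
  have "continuous_on UNIV (\<lambda>Q :: real ^ 'n ^ 'n. transpose Q ** Q)"
    unfolding transpose_def matrix_matrix_mult_def by (intro continuous_intros)
  moreover have "continuous_on UNIV (\<lambda>Q :: real ^ 'n ^ 'n. det Q)"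
    unfolding det_def by (intro continuous_intros)
  ultimately have "closed ({Q :: real ^ 'n ^ 'n. transpose Q ** Q = mat 1} \<inter> {Q. det Q = 1})"
    by (intro closed_Int closed_Collect_eq continuous_on_const)
  also have "\<dots> = {Q. rotation_matrix Q}"
    by (auto simp: rotation_matrix_def orthogonal_matrix)
  finally show "closed {Q :: real ^ 'n ^ 'n. rotation_matrix Q}" .
qed

lemma abs_powr_mult: "abs_powr p (s * t) = abs_powr p s * abs_powr p t"
  by (simp add: abs_powr_def abs_mult powr_mult)

text \<open>The flag selects the odd kernel when true and the even one when false, so that
  differentiation is simply negation of the flag.\<close>

definition signed_powr :: "bool \<Rightarrow> real \<Rightarrow> real \<Rightarrow> real" where
  "signed_powr e p s = (if e then sgn s else 1) * abs_powr p s"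

lemma signed_powr_measurable [measurable]: "signed_powr e p \<in> borel_measurable borel"
  unfolding signed_powr_def[abs_def] by measurable

lemma abs_signed_powr_le: "\<bar>signed_powr e p s\<bar> \<le> abs_powr p s"
  by (auto simp: signed_powr_def abs_mult abs_powr_nonneg sgn_if)

lemma signed_powr_scale: "c > 0 \<Longrightarrow> signed_powr e p (c * s) = c powr p * signed_powr e p s"
  by (simp add: signed_powr_def abs_powr_mult abs_powr_eq_powr sgn_mult)

lemma signed_powr_has_real_derivative:
  assumes "p > -1" "s \<noteq> 0"
  shows "(signed_powr (\<not> e) (p + 1) has_real_derivative (p + 1) * signed_powr e p s) (at s)"
proof -
  \<comment> \<open>Near \<open>s\<close> the sign is constant, so the absolute value is
    multiplication by \<open>\<delta>\<close>; \<open>\<kappa>\<close> is the sign factor of the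
    kernel with flag \<open>\<not> e\<close>.\<close>
  define \<delta> where "\<delta> = sgn s"
  define \<kappa> where "\<kappa> = (if e then 1 else \<delta>)"
  have \<delta>: "\<delta> * \<delta> = 1" "\<bar>s\<bar> = \<delta> * s" "\<delta> * s > 0" using assms(2) by (auto simp: \<delta>_def sgn_if)
  have "((\<lambda>t. \<kappa> * (\<delta> * t) powr (p + 1)) has_real_derivative
      \<kappa> * ((p + 1) * (\<delta> * s) powr (p + 1 - 1) * \<delta>)) (at s)"
    using \<delta>(3) by (auto intro!: derivative_eq_intros)
  then have D: "((\<lambda>t. \<kappa> * (\<delta> * t) powr (p + 1)) has_real_derivative (p + 1) * signed_powr e p s) (at s)"
  proof (rule DERIV_cong)
    show "\<kappa> * ((p + 1) * (\<delta> * s) powr (p + 1 - 1) * \<delta>) = (p + 1) * signed_powr e p s"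
  proof -
    have dd: "\<delta> * (\<delta> * y) = y" for y using \<delta>(1) by (simp add: mult.assoc[symmetric])
    then show ?thesis
      using \<delta> assms(2) by (auto simp: \<kappa>_def signed_powr_def abs_powr_def \<delta>_def[symmetric] dd algebra_simps)
  qed
  qed
  have ev: "eventually (\<lambda>t. \<kappa> * (\<delta> * t) powr (p + 1) = signed_powr (\<not> e) (p + 1) t) (nhds s)"
  proof (rule eventually_mono)
    show "eventually (\<lambda>t. \<delta> * t > 0) (nhds s)"
      by (rule order_tendstoD(1)[OF _ \<delta>(3)]) (auto intro!: tendsto_eq_intros filterlim_ident)
    fix t assume "\<delta> * t > 0"
    then have "sgn t = \<delta>" "\<bar>t\<bar> = \<delta> * t"
      by (auto simp: \<delta>_def sgn_if zero_less_mult_iff split: if_splits)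
    then show "\<kappa> * (\<delta> * t) powr (p + 1) = signed_powr (\<not> e) (p + 1) t"
      using assms(1) by (auto simp: \<kappa>_def signed_powr_def abs_powr_def)
  qed
  show ?thesis using D unfolding DERIV_cong_ev[OF refl ev refl] .
qed

lemma isCont_signed_powr:
  assumes "q > 0"
  shows "isCont (signed_powr e q) s"
proof (cases "s = 0")
  case False
  then show ?thesis
    using signed_powr_has_real_derivative[of "q - 1" s "\<not> e"] assms by (auto intro: DERIV_isCont)
next
  case True
  have "((\<lambda>s. \<bar>s\<bar> powr q) \<longlongrightarrow> 0) (at (0 :: real))"
    using assms by (auto intro!: tendsto_eq_intros)
  then have "((\<lambda>s. signed_powr e q s) \<longlongrightarrow> 0) (at 0)"
    by (rule Lim_null_comparison[rotated])
      (use abs_signed_powr_le[of e q] assms in \<open>auto simp: abs_powr_def\<close>)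
  moreover have "signed_powr e q 0 = 0" using assms by (simp add: signed_powr_def abs_powr_def)
  ultimately show ?thesis by (simp only: isCont_def True)
qed

text \<open>For \<open>p < 0\<close> the integrand is singular where the affine function vanishes.
  The primitive has exponent \<open>p + 1 > 0\<close> and stays continuous there, so one exceptional
  point is allowed in the fundamental theorem.\<close>

lemma signed_powr_FTC:
  assumes "p > -1" "a \<le> b"
  shows "((\<lambda>s. (p + 1) * signed_powr e p (\<alpha> + s * \<beta>) * \<beta>) has_integral
     signed_powr (\<not> e) (p + 1) (\<alpha> + b * \<beta>) - signed_powr (\<not> e) (p + 1) (\<alpha> + a * \<beta>)) {a..b}"
proof (cases "\<beta> = 0")
  case False
  have "((\<lambda>s. signed_powr (\<not> e) (p + 1) (\<alpha> + s * \<beta>)) has_vector_derivative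
      (p + 1) * signed_powr e p (\<alpha> + s * \<beta>) * \<beta>) (at s)" if "s \<noteq> - \<alpha> / \<beta>" for s
  proof -
    have "\<alpha> + s * \<beta> \<noteq> 0" using that False by (auto simp: field_simps add_eq_0_iff)
    from DERIV_chain2[where g = "\<lambda>s. \<alpha> + s * \<beta>", OF signed_powr_has_real_derivative[OF assms(1) this]]
    show ?thesis unfolding has_real_derivative_iff_has_vector_derivative[symmetric]
      by this (auto intro!: derivative_eq_intros)
  qed
  moreover have "continuous_on {a..b} (\<lambda>s. signed_powr (\<not> e) (p + 1) (\<alpha> + s * \<beta>))"
  proof (intro continuous_at_imp_continuous_on ballI)
    show "isCont (\<lambda>s. signed_powr (\<not> e) (p + 1) (\<alpha> + s * \<beta>)) s" for s
      by (rule isCont_o2[where g = "signed_powr (\<not> e) (p + 1)" and f = "\<lambda>s. \<alpha> + s * \<beta>"])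
        (use assms in \<open>auto intro!: isCont_signed_powr\<close>)
  qed
  ultimately show ?thesis
    using assms(2) by (intro fundamental_theorem_of_calculus_interior_strong[of "{- \<alpha> / \<beta>}"]) auto
qed auto

subsection \<open>Integrals over the sphere\<close>

text \<open>The measure lives on the Borel sets of the whole space and is concentrated on the sphere
  almost everywhere, so Borel functions on the space can be integrated without restricting
  them.\<close>

locale rotation_invariant_sphere = prob_space M for M :: "(real ^ 'd) measure" +
  assumes sets_M [measurable_cong]: "sets M = sets borel"
    and AE_norm: "AE v in M. norm v = 1"
    and card_ge_2: "2 \<le> CARD('d)"
    and distr_rotation: "rotation_matrix Q \<Longrightarrow> distr M M (\<lambda>v. Q *v v) = M"
begin

lemma measurable_rotation [measurable]: "(\<lambda>v. Q *v v) \<in> measurable M M"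
  using borel_measurable_matrix_vector_mult[of Q] by (simp cong: measurable_cong_sets add: sets_M)

lemma integral_rotation:
  assumes "rotation_matrix Q" and [measurable]: "f \<in> borel_measurable borel"
  shows "(\<integral>v. f (Q *v v) \<partial>M) = (\<integral>v. f v \<partial>M :: real)"
proof -
  have "(\<integral>v. f v \<partial>M) = (\<integral>v. f v \<partial>distr M M (\<lambda>v. Q *v v))"
    using assms by (simp add: distr_rotation)
  then show ?thesis by (simp add: integral_distr)
qed

lemma nn_integral_rotation:
  assumes "rotation_matrix Q" and [measurable]: "f \<in> borel_measurable borel"
  shows "(\<integral>\<^sup>+v. f (Q *v v) \<partial>M) = (\<integral>\<^sup>+v. f v \<partial>M)"
proof -
  have "(\<integral>\<^sup>+v. f v \<partial>M) = (\<integral>\<^sup>+v. f v \<partial>distr M M (\<lambda>v. Q *v v))"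
    using assms by (simp add: distr_rotation)
  then show ?thesis by (simp add: nn_integral_distr)
qed

text \<open>Fubini for the Gaussian weight: integrating first over \<open>x\<close> gives a product integral by
  rotation invariance of Lebesgue measure, integrating first over \<open>v\<close> gives a radial integral.\<close>

lemma nn_integral_abs_powr_inner:
  assumes p: "p > -1" and x: "x \<noteq> 0"
  shows "(\<integral>\<^sup>+v. ennreal (abs_powr p (x \<bullet> v)) \<partial>M) = ennreal (norm x powr p * funk_hecke_const CARD('d) p)"
proof -
  define k :: 'd where "k = undefined"
  define A where "A p = (\<integral>\<^sup>+v. ennreal (abs_powr p (axis k 1 \<bullet> v)) \<partial>M)" for p
  define V where "V = real CARD('d) * unit_ball_vol CARD('d) / 2"
  have V: "V > 0" by (simp add: V_def unit_ball_vol_pos)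
  \<comment> \<open>Rotating \<open>x\<close> to a multiple of the pole \<open>axis k 1\<close> and
    using homogeneity leaves one unknown number, \<open>A p\<close>.\<close>
  have zonal: "(\<integral>\<^sup>+v. ennreal (abs_powr p (x \<bullet> v)) \<partial>M) = ennreal (abs_powr p (norm x)) * A p"
    if "x \<noteq> 0" for p and x
  proof -
    have "norm (axis k 1 :: real ^ 'd) = norm (x /\<^sub>R norm x)" using that by simp
    then obtain Q where Q: "rotation_matrix Q" "Q *v axis k 1 = x /\<^sub>R norm x"
      using rotation_matrix_between[OF card_ge_2] by blast
    have "x = norm x *\<^sub>R (Q *v axis k 1)" using Q that by simp
    then have "x \<bullet> (Q *v v) = norm x * (axis k 1 \<bullet> v)" for v
      using rotation_matrix_inner[OF Q(1), of "axis k 1" v] by (metis inner_scaleR_left)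
    then have "(\<integral>\<^sup>+v. ennreal (abs_powr p (x \<bullet> (Q *v v))) \<partial>M) = ennreal (abs_powr p (norm x)) * A p"
      by (simp add: A_def abs_powr_mult ennreal_mult' abs_powr_nonneg nn_integral_cmult)
    then show ?thesis
      using nn_integral_rotation[OF Q(1), of "\<lambda>v. ennreal (abs_powr p (x \<bullet> v))"] by simp
  qed
  have A: "A p * ennreal (V * Gamma ((real CARD('d) + p) / 2)) =
      ennreal (Gamma ((p + 1) / 2) * sqrt pi ^ (CARD('d) - 1))" if p: "p > -1" for p
  proof -
    let ?f = "\<lambda>x v :: real ^ 'd. ennreal (abs_powr p (x \<bullet> v)) * ennreal (exp (- (norm x)\<^sup>2))"
    have d: "p > - real DIM(real ^ 'd)" using p card_ge_2 by simp
    have "AE x in lborel. (\<integral>\<^sup>+v. ?f x v \<partial>M) = A p * ennreal (abs_powr p (norm x) * exp (- (norm x)\<^sup>2))"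
      using AE_lborel_singleton[of "0 :: real ^ 'd"]
      by eventually_elim (simp add: nn_integral_multc zonal ennreal_mult' abs_powr_nonneg mult_ac)
    then have "(\<integral>\<^sup>+x. \<integral>\<^sup>+v. ?f x v \<partial>M \<partial>lborel) =
        (\<integral>\<^sup>+(x :: real ^ 'd). A p * ennreal (abs_powr p (norm x) * exp (- (norm x)\<^sup>2)) \<partial>lborel)"
      by (rule nn_integral_cong_AE)
    also have "\<dots> = A p * ennreal (V * Gamma ((real CARD('d) + p) / 2))"
      using nn_integral_abs_powr_norm_exp_square[OF d] by (simp add: nn_integral_cmult V_def)
    finally have 1: "(\<integral>\<^sup>+x. \<integral>\<^sup>+v. ?f x v \<partial>M \<partial>lborel) = A p * ennreal (V * Gamma ((real CARD('d) + p) / 2))" .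
    \<comment> \<open>A rotation taking the pole to \<open>v\<close> reduces the inner Gaussian
      integral to the coordinate direction.\<close>
    have "(\<integral>\<^sup>+x. ?f x v \<partial>lborel) = ennreal (Gamma ((p + 1) / 2) * sqrt pi ^ (CARD('d) - 1))" if "norm v = 1" for v
    proof -
      have "norm (axis k 1 :: real ^ 'd) = norm v" using that by simp
      then obtain Q where Q: "rotation_matrix Q" "Q *v axis k 1 = v"
        using rotation_matrix_between[OF card_ge_2] by blast
      have "(\<integral>\<^sup>+x. ?f x v \<partial>lborel) = (\<integral>\<^sup>+x. ?f x v \<partial>distr lborel borel (\<lambda>x. Q *v x))"
        by (simp add: lborel_distr_rotation[OF Q(1)])
      also have "\<dots> = (\<integral>\<^sup>+x. ?f (Q *v x) v \<partial>lborel)" by (subst nn_integral_distr) auto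
      also have "\<dots> = (\<integral>\<^sup>+(x :: real ^ 'd). ennreal (abs_powr p (x \<bullet> axis k 1) * exp (- (norm x)\<^sup>2)) \<partial>lborel)"
        by (simp add: Q(2)[symmetric] rotation_matrix_inner[OF Q(1)] rotation_matrix_norm[OF Q(1)] ennreal_mult' abs_powr_nonneg)
      also have "\<dots> = ennreal (Gamma ((p + 1) / 2) * sqrt pi ^ (CARD('d) - 1))"
        using nn_integral_abs_powr_inner_exp_square[OF p, of "axis k 1 :: real ^ 'd"] by (simp add: axis_in_Basis_iff)
      finally show ?thesis .
    qed
    then have "(\<integral>\<^sup>+v. \<integral>\<^sup>+x. ?f x v \<partial>lborel \<partial>M) = (\<integral>\<^sup>+v. ennreal (Gamma ((p + 1) / 2) * sqrt pi ^ (CARD('d) - 1)) \<partial>M)"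
      by (intro nn_integral_cong_AE eventually_mono[OF AE_norm])
    also have "\<dots> = ennreal (Gamma ((p + 1) / 2) * sqrt pi ^ (CARD('d) - 1))"
      by (simp add: emeasure_space_1)
    finally have 2: "(\<integral>\<^sup>+v. \<integral>\<^sup>+x. ?f x v \<partial>lborel \<partial>M) = ennreal (Gamma ((p + 1) / 2) * sqrt pi ^ (CARD('d) - 1))" .
    interpret pair_sigma_finite lborel M ..
    have "(\<integral>\<^sup>+v. \<integral>\<^sup>+x. ?f x v \<partial>lborel \<partial>M) = (\<integral>\<^sup>+x. \<integral>\<^sup>+v. ?f x v \<partial>M \<partial>lborel)"
      by (rule Fubini') measurable
    then show ?thesis using 1 2 by simp
  qed
  have Gpos: "Gamma ((real CARD('d) + q) / 2) > 0" if "q > -1" for q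
    using that card_ge_2 by (intro Gamma_real_pos) auto
  have A0: "A 0 = 1" by (simp add: A_def abs_powr_def emeasure_space_1)
  \<comment> \<open>At \<open>p = 0\<close> the moment is the total mass 1, so the Fubini identity
    \<open>A\<close> calibrates \<open>V\<close> in terms of \<open>sqrt pi\<close> and
    Gamma.\<close>
  have pi: "sqrt pi * sqrt pi ^ (CARD('d) - 1) = V * Gamma (real CARD('d) / 2)"
  proof -
    have "ennreal (V * Gamma (real CARD('d) / 2)) = ennreal (sqrt pi * sqrt pi ^ (CARD('d) - 1))"
      using A[of 0] unfolding A0 by (simp only: Gamma_one_half_real add_0 add_0_right mult_1)
    moreover have "0 \<le> V * Gamma (real CARD('d) / 2)" using V Gpos[of 0] by simp
    ultimately show ?thesis by (subst (asm) ennreal_inj) auto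
  qed
  have A_val: "A p = ennreal (funk_hecke_const CARD('d) p)"
  proof -
    have K: "V * Gamma ((real CARD('d) + p) / 2) > 0" using V Gpos[OF p] by simp
    have "A p = A p * ennreal (V * Gamma ((real CARD('d) + p) / 2)) / ennreal (V * Gamma ((real CARD('d) + p) / 2))"
      using K by (intro ennreal_mult_divide_eq[symmetric]) auto
    also have "\<dots> = ennreal (Gamma ((p + 1) / 2) * sqrt pi ^ (CARD('d) - 1)) / ennreal (V * Gamma ((real CARD('d) + p) / 2))"
      unfolding A[OF p] ..
    also have "\<dots> = ennreal (Gamma ((p + 1) / 2) * sqrt pi ^ (CARD('d) - 1) / (V * Gamma ((real CARD('d) + p) / 2)))"
      using K p by (subst divide_ennreal) (auto intro!: Gamma_real_nonneg)
    also have "sqrt pi ^ (CARD('d) - 1) = V * Gamma (real CARD('d) / 2) / sqrt pi"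
      unfolding pi[symmetric] by simp
    also have "Gamma ((p + 1) / 2) * (V * Gamma (real CARD('d) / 2) / sqrt pi) / (V * Gamma ((real CARD('d) + p) / 2)) =
        funk_hecke_const CARD('d) p"
      using V by (simp add: funk_hecke_const_def)
    finally show ?thesis .
  qed
  have e: "abs_powr p (norm x) = norm x powr p" using x by (intro abs_powr_eq_powr) simp
  show ?thesis
    unfolding zonal[OF x] A_val e ennreal_mult'[OF powr_ge_zero] ..
qed

lemma funk_hecke_const_nonneg:
  "p > -1 \<Longrightarrow> 0 \<le> funk_hecke_const CARD('d) p"
  using card_ge_2 by (auto simp: funk_hecke_const_def intro!: divide_nonneg_nonneg mult_nonneg_nonneg Gamma_real_nonneg)

text \<open>The explicit absolute moment is finite, which gives integrability even in the singular
  range \<open>p < 0\<close>.\<close>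

lemma integrable_signed_powr:
  assumes p: "p > -1" and x: "x \<noteq> 0"
  shows "integrable M (\<lambda>v. signed_powr e p (x \<bullet> v))"
proof (rule integrableI_bounded)
  have "(\<integral>\<^sup>+v. ennreal (norm (signed_powr e p (x \<bullet> v))) \<partial>M) \<le> (\<integral>\<^sup>+v. ennreal (abs_powr p (x \<bullet> v)) \<partial>M)"
    by (intro nn_integral_mono ennreal_leI) (simp add: abs_signed_powr_le)
  then show "(\<integral>\<^sup>+v. ennreal (norm (signed_powr e p (x \<bullet> v))) \<partial>M) < \<infinity>"
    by (simp add: nn_integral_abs_powr_inner[OF assms] le_less_trans ennreal_less_top)
qed measurable

lemma bounded_AE:
  assumes "continuous_on UNIV g"
  obtains B :: real where "B \<ge> 0" "\<And>v :: real ^ 'd. norm v = 1 \<Longrightarrow> \<bar>g v\<bar> \<le> B" "AE v in M. \<bar>g v\<bar> \<le> B"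
proof -
  have "bounded (g ` sphere 0 1)"
    by (intro compact_imp_bounded compact_continuous_image continuous_on_subset[OF assms]) auto
  then obtain B where B: "B > 0" "\<And>v. norm v = 1 \<Longrightarrow> \<bar>g v\<bar> \<le> B"
    by (auto simp: bounded_pos)
  have "AE v in M. \<bar>g v\<bar> \<le> B" using AE_norm by eventually_elim (rule B)
  then show thesis using that[of B] B by simp
qed

lemma integrable_signed_powr_mult:
  assumes "p > -1" "x \<noteq> 0" and g: "continuous_on UNIV g"
  shows "integrable M (\<lambda>v. signed_powr e p (x \<bullet> v) * g v)"
proof -
  have [measurable]: "g \<in> borel_measurable borel" using g by (rule borel_measurable_continuous_onI)
  obtain B where "B \<ge> 0" "AE v in M. \<bar>g v\<bar> \<le> B" using bounded_AE[OF g] by metis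
  show ?thesis
  proof (rule Bochner_Integration.integrable_bound)
    show "integrable M (\<lambda>v. B * signed_powr e p (x \<bullet> v))"
      by (intro integrable_mult_right integrable_signed_powr assms)
    show "AE v in M. norm (signed_powr e p (x \<bullet> v) * g v) \<le> norm (B * signed_powr e p (x \<bullet> v))"
      using \<open>AE v in M. \<bar>g v\<bar> \<le> B\<close>
      by eventually_elim (use \<open>B \<ge> 0\<close> in \<open>auto simp: abs_mult mult.commute intro!: mult_right_mono\<close>)
  qed measurable
qed

lemma integral_signed_powr:
  assumes p: "p > -1" and x: "x \<noteq> 0"
  shows "(\<integral>v. signed_powr e p (x \<bullet> v) \<partial>M) = (if e then 0 else funk_hecke_const CARD('d) p * norm x powr p)"
proof (cases e)
  case True
  \<comment> \<open>A rotation that takes this particular \<open>x\<close> to \<open>- x\<close>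
    serves in every dimension; the antipodal map itself has determinant -1 in odd
    dimensions.\<close>
  obtain Q where Q: "rotation_matrix Q" "Q *v x = - x"
    using rotation_matrix_between[OF card_ge_2, of x "- x"] by auto
  have "x \<bullet> (Q *v v) = - (x \<bullet> v)" for v
    using rotation_matrix_inner[OF Q(1), of x v] by (simp add: Q(2) minus_equation_iff)
  moreover have "signed_powr e p (- s) = - signed_powr e p s" for s
    using True by (simp add: signed_powr_def abs_powr_def sgn_minus)
  ultimately have "(\<integral>v. signed_powr e p (x \<bullet> (Q *v v)) \<partial>M) = - (\<integral>v. signed_powr e p (x \<bullet> v) \<partial>M)"
    by simp
  then show ?thesis
    using integral_rotation[OF Q(1), of "\<lambda>v. signed_powr e p (x \<bullet> v)"] True by simp
next
  case False
  then have "(\<integral>v. signed_powr e p (x \<bullet> v) \<partial>M) = enn2real (\<integral>\<^sup>+v. ennreal (abs_powr p (x \<bullet> v)) \<partial>M)"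
    by (subst integral_eq_nn_integral) (auto simp: signed_powr_def abs_powr_nonneg)
  then show ?thesis
    using False funk_hecke_const_nonneg[OF p] by (simp add: nn_integral_abs_powr_inner[OF assms] mult_ac)
qed

text \<open>No uniform integrability is needed for continuity: moving \<open>x\<close> by a rotation amounts to
  rotating the continuous factor \<open>g\<close>, and the sphere is a quotient of the compact rotation group.\<close>

lemma continuous_on_integral_signed_powr:
  assumes p: "p > -1" and g: "continuous_on UNIV g"
  shows "continuous_on (- {0}) (\<lambda>x. \<integral>v. signed_powr e p (x \<bullet> v) * g v \<partial>M)"
proof -
  define F where "F x = (\<integral>v. signed_powr e p (x \<bullet> v) * g v \<partial>M)" for x
  have [measurable]: "g \<in> borel_measurable borel" using g by (rule borel_measurable_continuous_onI)
  obtain B where B: "B \<ge> 0" "\<And>v. norm v = 1 \<Longrightarrow> \<bar>g v\<bar> \<le> B" using bounded_AE[OF g] by metis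
  let ?SO = "{Q :: real ^ 'd ^ 'd. rotation_matrix Q}"
  define x0 :: "real ^ 'd" where "x0 = axis undefined 1"
  have x0: "norm x0 = 1" "x0 \<noteq> 0" by (auto simp: x0_def)
  \<comment> \<open>The singular kernel has the fixed pole \<open>x0\<close>; \<open>Q\<close>
    enters only through the continuous bounded factor, so dominated convergence applies.\<close>
  define h where "h Q = (\<integral>v. signed_powr e p (x0 \<bullet> v) * g (Q *v v) \<partial>M)" for Q
  have Fh: "F (Q *v x0) = h Q" if "rotation_matrix Q" for Q
    using integral_rotation[OF that, of "\<lambda>v. signed_powr e p ((Q *v x0) \<bullet> v) * g v"]
    by (simp add: F_def h_def rotation_matrix_inner[OF that])
  have h: "continuous_on ?SO h"
    unfolding continuous_on_sequentially o_def
  proof safe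
    fix X a assume X: "\<forall>n. X n \<in> ?SO" "X \<longlonglongrightarrow> a" and a: "rotation_matrix a"
    show "(\<lambda>n. h (X n)) \<longlonglongrightarrow> h a"
      unfolding h_def
    proof (rule integral_dominated_convergence)
      show "integrable M (\<lambda>v. \<bar>signed_powr e p (x0 \<bullet> v)\<bar> * B)"
        by (intro integrable_mult_left integrable_abs integrable_signed_powr p x0)
      show "AE v in M. (\<lambda>n. signed_powr e p (x0 \<bullet> v) * g (X n *v v)) \<longlonglongrightarrow> signed_powr e p (x0 \<bullet> v) * g (a *v v)"
      proof (intro AE_I2 tendsto_mult_left)
        fix v
        have "(\<lambda>n. X n *v v) \<longlonglongrightarrow> a *v v"
          by (rule continuous_on_tendsto_compose[OF continuous_on_matrix_vector_mult[of UNIV] X(2)]) auto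
        then show "(\<lambda>n. g (X n *v v)) \<longlonglongrightarrow> g (a *v v)"
          by (rule continuous_on_tendsto_compose[OF g]) auto
      qed
      show "AE v in M. norm (signed_powr e p (x0 \<bullet> v) * g (X n *v v)) \<le> \<bar>signed_powr e p (x0 \<bullet> v)\<bar> * B" for n
        using AE_norm X(1)
        by (auto simp: abs_mult rotation_matrix_norm elim!: eventually_mono intro!: mult_left_mono B)
    qed measurable
  qed
  have "continuous_on (sphere 0 1) F"
  proof (subst continuous_on_closed_vimage, rule closed_sphere, intro allI impI)
    fix C :: "real set" assume "closed C"
    then have "closed (h -` C \<inter> ?SO)"
      using h unfolding continuous_on_closed_vimage[OF compact_imp_closed[OF compact_rotation_matrices]] by blast
    then have "compact (?SO \<inter> (h -` C \<inter> ?SO))"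
      by (intro compact_Int_closed compact_rotation_matrices)
    then have "compact ((\<lambda>Q. Q *v x0) ` (?SO \<inter> (h -` C \<inter> ?SO)))"
      by (intro compact_continuous_image continuous_on_matrix_vector_mult)
    moreover have "(\<lambda>Q. Q *v x0) ` (?SO \<inter> (h -` C \<inter> ?SO)) = F -` C \<inter> sphere 0 1"
    proof (intro equalityI subsetI)
      fix x assume x: "x \<in> F -` C \<inter> sphere 0 1"
      then have "norm x0 = norm x" using x0 by simp
      then obtain Q where Q: "rotation_matrix Q" "Q *v x0 = x"
        using rotation_matrix_between[OF card_ge_2] by blast
      then have "h Q \<in> C" using x Fh[OF Q(1)] by simp
      then show "x \<in> (\<lambda>Q. Q *v x0) ` (?SO \<inter> (h -` C \<inter> ?SO))"
        using Q by blast
    next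
      fix x assume "x \<in> (\<lambda>Q. Q *v x0) ` (?SO \<inter> (h -` C \<inter> ?SO))"
      then obtain Q where Q: "rotation_matrix Q" "h Q \<in> C" and x: "x = Q *v x0" by blast
      then show "x \<in> F -` C \<inter> sphere 0 1"
        unfolding x by (simp add: Fh[OF Q(1)] rotation_matrix_norm x0(1))
    qed
    ultimately show "closed (F -` C \<inter> sphere 0 1)" by (metis compact_imp_closed)
  qed
  \<comment> \<open>Homogeneity of degree \<open>p\<close> extends continuity from the sphere to the
    punctured space.\<close>
  then have cont: "continuous_on (- {0}) (\<lambda>x. norm x powr p * F (x /\<^sub>R norm x))"
  proof (intro continuous_on_mult)
    show "continuous_on (- {0}) (\<lambda>x :: real ^ 'd. norm x powr p)"
      by (intro continuous_on_powr continuous_on_norm_id continuous_on_const) auto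
    have "continuous_on (- {0}) (\<lambda>x :: real ^ 'd. x /\<^sub>R norm x)"
      by (intro continuous_on_scaleR continuous_on_inverse continuous_on_norm_id continuous_on_id) auto
    moreover have "norm (x /\<^sub>R norm x) = 1" if "x \<noteq> 0" for x :: "real ^ 'd" using that by simp
    then have "(\<lambda>x :: real ^ 'd. x /\<^sub>R norm x) ` (- {0}) \<subseteq> sphere 0 1"
      by (intro image_subsetI) (simp only: mem_sphere_0 Compl_iff singleton_iff simp_thms)
    ultimately show "continuous_on (- {0}) (\<lambda>x. F (x /\<^sub>R norm x))"
      using \<open>continuous_on (sphere 0 1) F\<close> by (rule continuous_on_compose2[rotated])
  qed
  have F: "F x = norm x powr p * F (x /\<^sub>R norm x)" if "x \<in> - {0}" for x
  proof -
    have x: "norm x > 0" using that by simp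
    have "signed_powr e p (x \<bullet> v) = norm x powr p * signed_powr e p ((x /\<^sub>R norm x) \<bullet> v)" for v
      unfolding signed_powr_scale[OF x, symmetric]
      by (rule arg_cong[where f = "signed_powr e p"]) (use x in simp)
    then show ?thesis by (simp only: F_def mult.assoc integral_mult_right_zero)
  qed
  have "continuous_on (- {0}) F"
    by (rule continuous_on_eq[OF cont F[symmetric]])
  then show ?thesis unfolding F_def[abs_def] .
qed

text \<open>For \<open>p < 0\<close> the differentiated kernel is singular on a hyperplane that
  moves with \<open>t\<close>. So the derivative is first integrated in \<open>t\<close>, the
  integrals are exchanged by Fubini, and continuity of the resulting integrand allows
  differentiating back.\<close>

lemma has_real_derivative_integral_signed_powr:
  assumes p: "p > -1" and x: "x \<noteq> 0" and g: "continuous_on UNIV g"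
  shows "((\<lambda>t. \<integral>v. signed_powr (\<not> e) (p + 1) ((x + t *\<^sub>R axis i 1) \<bullet> v) * g v \<partial>M) has_real_derivative
     (p + 1) * (\<integral>v. signed_powr e p (x \<bullet> v) * (v $ i * g v) \<partial>M)) (at 0)"
proof -
  define a :: "real ^ 'd" where "a = axis i 1"
  \<comment> \<open>Half the norm keeps the segment away from the origin: its points have norm
    between \<open>r\<close> and \<open>3 * r\<close>.\<close>
  define r where "r = norm x / 2"
  define G where "G t = (\<integral>v. signed_powr (\<not> e) (p + 1) ((x + t *\<^sub>R a) \<bullet> v) * g v \<partial>M)" for t
  define F where "F t = (\<integral>v. signed_powr e p ((x + t *\<^sub>R a) \<bullet> v) * (v $ i * g v) \<partial>M)" for t
  define c where "c = funk_hecke_const CARD('d) p"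
  have [measurable]: "g \<in> borel_measurable borel" using g by (rule borel_measurable_continuous_onI)
  have r: "r > 0" using x by (simp add: r_def)
  have a: "a \<bullet> v = v $ i" "norm a = 1" for v by (simp_all add: a_def inner_axis')
  have nrm: "r \<le> norm (x + t *\<^sub>R a)" "norm (x + t *\<^sub>R a) \<le> 3 * r" if "t \<in> {-r..r}" for t
  proof -
    have "norm (t *\<^sub>R a) \<le> r" using that by (auto simp: a)
    then show "r \<le> norm (x + t *\<^sub>R a)" "norm (x + t *\<^sub>R a) \<le> 3 * r"
      using norm_diff_ineq[of x "t *\<^sub>R a"] norm_triangle_ineq[of x "t *\<^sub>R a"] by (auto simp: r_def)
  qed
  then have nz: "x + t *\<^sub>R a \<noteq> 0" if "t \<in> {-r..r}" for t
    using that r by fastforce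
  have g': "continuous_on UNIV (\<lambda>v. v $ i * g v)"
    by (intro continuous_on_mult g continuous_on_component continuous_on_id)
  have contF: "continuous_on {-r..r} F"
    unfolding F_def
    by (rule continuous_on_compose2[OF continuous_on_integral_signed_powr[OF p g'], where f = "\<lambda>t. x + t *\<^sub>R a"])
      (auto intro!: continuous_intros simp: nz)
  have key: "G t = G (- r) + (p + 1) * integral {-r..t} F" if t: "t \<in> {-r..r}" for t
  proof -
    note tonelli = nn_integral_fst
    interpret pair_sigma_finite lborel M ..
    define f where "f s v = indicator {-r..t} s * ((p + 1) * signed_powr e p ((x + s *\<^sub>R a) \<bullet> v) * (a \<bullet> v) * g v)" for s v
    have meas [measurable]: "case_prod f \<in> borel_measurable (lborel \<Otimes>\<^sub>M M)"
      unfolding f_def by measurable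
    obtain B where B: "B \<ge> 0" "AE v in M. \<bar>v $ i * g v\<bar> \<le> B" using bounded_AE[OF g'] by metis
    \<comment> \<open>The sum of both powers bounds the power of the norm for either sign of
      \<open>p\<close>: the maximum over the range is at \<open>3 * r\<close> or at
      \<open>r\<close>.\<close>
    define K where "K = (p + 1) * B * ((r powr p + (3 * r) powr p) * c)"
    have int: "integrable (lborel \<Otimes>\<^sub>M M) (case_prod f)"
    proof (rule integrableI_bounded[OF meas])
      have c0: "c \<ge> 0" unfolding c_def by (rule funk_hecke_const_nonneg[OF p])
      have le: "(\<integral>\<^sup>+v. ennreal (norm (f s v)) \<partial>M) \<le> ennreal K * indicator {-r..r} s" for s
      proof (cases "s \<in> {-r..t}")
        case True
        then have s: "s \<in> {-r..r}" using t by auto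
        have "AE v in M. ennreal (norm (f s v)) \<le> ennreal ((p + 1) * B) * ennreal (abs_powr p ((x + s *\<^sub>R a) \<bullet> v))"
          using B(2)
        proof eventually_elim
          case (elim v)
          have "norm (f s v) = (p + 1) * (\<bar>signed_powr e p ((x + s *\<^sub>R a) \<bullet> v)\<bar> * \<bar>v $ i * g v\<bar>)"
            using True p by (simp add: f_def abs_mult a mult_ac)
          also have "\<dots> \<le> (p + 1) * (abs_powr p ((x + s *\<^sub>R a) \<bullet> v) * B)"
            using p by (intro mult_left_mono mult_mono abs_signed_powr_le elim abs_powr_nonneg) auto
          finally show ?case
            using p B(1) by (subst ennreal_mult'[symmetric]) (auto intro!: ennreal_leI simp: mult_ac)
        qed
        then have "(\<integral>\<^sup>+v. ennreal (norm (f s v)) \<partial>M) \<le>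
            (\<integral>\<^sup>+v. ennreal ((p + 1) * B) * ennreal (abs_powr p ((x + s *\<^sub>R a) \<bullet> v)) \<partial>M)"
          by (rule nn_integral_mono_AE)
        also have "\<dots> = ennreal ((p + 1) * B) * ennreal (norm (x + s *\<^sub>R a) powr p * c)"
          by (subst nn_integral_cmult) (auto simp: nn_integral_abs_powr_inner[OF p nz[OF s]] c_def)
        also have "\<dots> \<le> ennreal K"
        proof -
          have "norm (x + s *\<^sub>R a) powr p \<le> r powr p + (3 * r) powr p"
          proof (cases "p \<ge> 0")
            case True
            then have "norm (x + s *\<^sub>R a) powr p \<le> (3 * r) powr p"
              using nrm[OF s] by (intro powr_mono2) auto
            then show ?thesis by (simp add: add_increasing)
          next
            case False
            then have "norm (x + s *\<^sub>R a) powr p \<le> r powr p"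
              using nrm[OF s] r by (intro powr_mono2') auto
            then show ?thesis by (simp add: add_increasing2)
          qed
          then have "(p + 1) * B * (norm (x + s *\<^sub>R a) powr p * c) \<le> K"
            unfolding K_def using p B(1) c0 by (intro mult_left_mono mult_right_mono) auto
          then show ?thesis
            using p B(1) by (subst ennreal_mult'[symmetric]) (auto intro!: ennreal_leI)
        qed
        finally show ?thesis using s by simp
      qed (simp add: f_def)
      have "(\<integral>\<^sup>+z. ennreal (norm (case_prod f z)) \<partial>(lborel \<Otimes>\<^sub>M M)) = (\<integral>\<^sup>+s. \<integral>\<^sup>+v. ennreal (norm (f s v)) \<partial>M \<partial>lborel)"
        using tonelli[of "\<lambda>z. ennreal (norm (case_prod f z))" lborel] by simp
      also have "\<dots> \<le> (\<integral>\<^sup>+s. ennreal K * indicator {-r..r} s \<partial>lborel)"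
        by (intro nn_integral_mono le)
      also have "\<dots> < \<infinity>"
        using r by (subst nn_integral_cmult) (auto simp: ennreal_mult_less_top)
      finally show "(\<integral>\<^sup>+z. ennreal (norm (case_prod f z)) \<partial>(lborel \<Otimes>\<^sub>M M)) < \<infinity>" .
    qed
    let ?D = "\<lambda>v. signed_powr (\<not> e) (p + 1) ((x + t *\<^sub>R a) \<bullet> v) * g v - signed_powr (\<not> e) (p + 1) ((x + (- r) *\<^sub>R a) \<bullet> v) * g v"
    \<comment> \<open>Fubini gives integrability in \<open>s\<close> for almost every
      \<open>v\<close>; for such \<open>v\<close> the Lebesgue integral agrees with the gauge
      integral of \<open>signed_powr_FTC\<close>.\<close>
    have "AE v in M. (\<integral>s. f s v \<partial>lborel) = ?D v"
      using AE_integrable_snd[OF int]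
    proof eventually_elim
      case (elim v)
      define h where "h s = (p + 1) * signed_powr e p ((x + s *\<^sub>R a) \<bullet> v) * (a \<bullet> v) * g v" for s
      have "(h has_integral ?D v) {-r..t}"
        using has_integral_mult_left[OF signed_powr_FTC[OF p, of "-r" t e "x \<bullet> v" "a \<bullet> v"], of "g v"] t
        by (simp add: h_def[abs_def] inner_add_left inner_diff_left left_diff_distrib)
      moreover have "set_integrable lborel {-r..t} h"
        using elim by (simp add: set_integrable_def f_def h_def)
      then have "(\<integral>s\<in>{-r..t}. h s \<partial>lborel) = integral {-r..t} h" by (rule set_borel_integral_eq_integral)
      moreover have "(\<integral>s. f s v \<partial>lborel) = (\<integral>s\<in>{-r..t}. h s \<partial>lborel)"
        by (simp only: set_lebesgue_integral_def f_def h_def real_scaleR_def)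
      ultimately show ?case by (metis integral_unique)
    qed
    then have "(\<integral>v. (\<integral>s. f s v \<partial>lborel) \<partial>M) = (\<integral>v. ?D v \<partial>M)"
      by (intro integral_cong_AE) (auto intro: borel_measurable_integrable[OF integrable_snd[OF int]])
    also have "\<dots> = G t - G (- r)"
      unfolding G_def
      by (intro Bochner_Integration.integral_diff integrable_signed_powr_mult g nz) (use p t r in auto)
    finally have "G t - G (- r) = (\<integral>s. (\<integral>v. f s v \<partial>M) \<partial>lborel)"
      using Fubini_integral[OF int] by simp
    also have "\<dots> = (\<integral>s\<in>{-r..t}. (p + 1) * F s \<partial>lborel)"
      unfolding set_lebesgue_integral_def
    proof (rule Bochner_Integration.integral_cong[OF refl])
      fix s
      have "(\<integral>v. f s v \<partial>M) = (\<integral>v. (indicator {-r..t} s * (p + 1)) * (signed_powr e p ((x + s *\<^sub>R a) \<bullet> v) * (v $ i * g v)) \<partial>M)"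
        by (intro Bochner_Integration.integral_cong) (auto simp: f_def a mult_ac)
      then show "(\<integral>v. f s v \<partial>M) = indicator {-r..t} s *\<^sub>R ((p + 1) * F s)"
        by (simp add: F_def)
    qed
    also have "\<dots> = integral {-r..t} (\<lambda>s. (p + 1) * F s)"
    proof (rule set_borel_integral_eq_integral, rule borel_integrable_atLeastAtMost')
      show "continuous_on {-r..t} (\<lambda>s. (p + 1) * F s)"
        using t by (intro continuous_on_mult_left continuous_on_subset[OF contF]) auto
    qed
    finally show ?thesis by simp
  qed
  have "((\<lambda>t. integral {-r..t} F) has_real_derivative F 0) (at 0 within {-r..r})"
    using contF r by (intro integral_has_real_derivative) auto
  then have "((\<lambda>t. integral {-r..t} F) has_real_derivative F 0) (at 0)"
    using r by (subst (asm) at_within_Icc_at) auto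
  from DERIV_add[OF DERIV_const DERIV_cmult[OF this]]
  have "((\<lambda>t. G (- r) + (p + 1) * integral {-r..t} F) has_real_derivative 0 + (p + 1) * F 0) (at 0)" .
  then have "(G has_real_derivative 0 + (p + 1) * F 0) (at 0)"
  proof (rule has_field_derivative_transform_within_open[where S = "{-r<..<r}"])
    show "G (- r) + (p + 1) * integral {-r..t} F = G t" if "t \<in> {-r<..<r}" for t
      by (rule key[symmetric]) (use that in auto)
  qed (use r in auto)
  then show ?thesis by (simp add: G_def[abs_def] F_def a_def)
qed

end

subsection \<open>The recursion for the multipliers\<close>

text \<open>The recursion with \<open>Suc l\<close> in place of \<open>l\<close>, so the factor
  reads \<open>p + 1 - real l\<close>. The base case is the integral of the kernel over the sphere
  for a unit vector.\<close>

fun abs_powr_multiplier :: "nat \<Rightarrow> bool \<Rightarrow> nat \<Rightarrow> real \<Rightarrow> real" where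
  "abs_powr_multiplier d e 0 p = (if e then 0 else funk_hecke_const d p)"
| "abs_powr_multiplier d e (Suc l) p = (p + 1 - real l) / (p + 1) * abs_powr_multiplier d (\<not> e) l (p + 1)"

text \<open>Two steps restore the parity flag, so odd degrees descend to degree 1 with the even
  kernel and then to degree 0 with the odd kernel, where the value is 0.\<close>

lemma abs_powr_multiplier_odd: "abs_powr_multiplier d False (2 * n + 1) p = 0"
proof (induction n arbitrary: p)
  case (Suc n)
  have "2 * Suc n + 1 = Suc (Suc (2 * n + 1))" by simp
  then show ?case
    using Suc[of "p + 1 + 1"] by (simp only: abs_powr_multiplier.simps(2) not_not mult_zero_right)
qed simp

text \<open>Two steps of the recursion at once: the degree drops by two while \<open>p\<close> grows
  by two, and the constant changes by the functional equation of Gamma.\<close>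

lemma abs_powr_multiplier_even:
  assumes "d > 0" "p > -1"
  shows "abs_powr_multiplier d False (2 * n) p =
    funk_hecke_const d p * ((-1) ^ n * pochhammer (- p / 2) n / pochhammer ((real d + p) / 2) n)"
  using assms(2)
proof (induction n arbitrary: p)
  case 0
  then show ?case by simp
next
  case (Suc n)
  \<comment> \<open>\<open>a\<close> is the upper Pochhammer argument at exponent
    \<open>p + 2\<close>, so \<open>a + 1\<close> is the one at \<open>p\<close>; the lower
    arguments are \<open>b + 1\<close> at \<open>p + 2\<close> and \<open>b\<close> at
    \<open>p\<close>.\<close>
  define a where "a = - (p + 2) / 2"
  define b where "b = (real d + p) / 2"
  define X where "X = pochhammer (a + 1) n"
  define Y where "Y = pochhammer (b + 1) n"
  have p: "p > -1" and a0: "a \<noteq> 0" "p + 1 \<noteq> 0" "p + 2 \<noteq> 0" using Suc.prems by (auto simp: a_def)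
  have b: "b > 0" using Suc.prems assms(1) by (simp add: b_def)
  have Y: "Y > 0" unfolding Y_def using b by (intro pochhammer_pos) auto
  have c: "funk_hecke_const d (p + 2) = funk_hecke_const d p * ((p + 1) / 2) / b"
  proof -
    have G: "Gamma (y + 1) = y * Gamma y" if "y > 0" for y :: real
      by (rule Gamma_plus1) (use that in \<open>auto elim!: nonpos_Ints_cases\<close>)
    have "(p + 2 + 1) / 2 = (p + 1) / 2 + 1" "(real d + (p + 2)) / 2 = b + 1"
      by (simp_all add: b_def field_simps)
    then have G': "Gamma ((p + 2 + 1) / 2) = (p + 1) / 2 * Gamma ((p + 1) / 2)"
      "Gamma ((real d + (p + 2)) / 2) = b * Gamma b"
      using p b by (simp_all only: G) (simp_all add: G)
    show ?thesis unfolding funk_hecke_const_def G' by (simp add: b_def mult_ac)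
  qed
  \<comment> \<open>Splitting the symbol of length \<open>Suc n\<close> at \<open>a\<close> from the
    front and from the back shifts its argument from \<open>a\<close> to
    \<open>a + 1\<close>.\<close>
  have "a * X = pochhammer a n * (a + real n)"
    unfolding X_def by (metis pochhammer_Suc pochhammer_rec)
  then have X: "X * (p + 2) = pochhammer a n * (p + 2 - 2 * real n)"
    by (simp add: a_def field_simps)
  have "abs_powr_multiplier d False (2 * Suc n) p =
      (p - 2 * real n) / (p + 1) * ((p + 2 - 2 * real n) / (p + 2)) * abs_powr_multiplier d False (2 * n) (p + 2)"
    by (simp add: add_ac)
  also have "abs_powr_multiplier d False (2 * n) (p + 2) =
      funk_hecke_const d p * ((p + 1) / 2) / b * ((-1) ^ n * pochhammer a n / Y)"
    using Suc.IH[of "p + 2"] p by (simp add: c a_def Y_def b_def add_divide_distrib add_ac)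
  also have "(p - 2 * real n) / (p + 1) * ((p + 2 - 2 * real n) / (p + 2)) * (funk_hecke_const d p * ((p + 1) / 2) / b * ((-1) ^ n * pochhammer a n / Y))
      = funk_hecke_const d p * ((-1) ^ n * (p - 2 * real n) / 2 * (pochhammer a n * (p + 2 - 2 * real n) / (p + 2)) / (b * Y))"
  proof -
    have "A / u * (B / w) * (F * (u / 2) / b * (S * H / Y)) = F * (S * A / 2 * (H * B / w) / (b * Y))"
      if "u \<noteq> 0" for A B u w F S H :: real
      using that by (simp add: mult_ac)
    from this[OF a0(2)] show ?thesis .
  qed
  also have "pochhammer a n * (p + 2 - 2 * real n) / (p + 2) = X"
    using X a0 by (simp add: field_simps)
  also have "(-1) ^ n * (p - 2 * real n) / 2 * X / (b * Y) = (-1) ^ Suc n * pochhammer (- p / 2) (Suc n) / pochhammer b (Suc n)"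
  proof -
    have e1: "pochhammer (- p / 2) (Suc n) = X * (- p / 2 + real n)"
      by (simp add: pochhammer_Suc X_def a_def field_simps)
    have e2: "pochhammer b (Suc n) = b * Y" by (simp add: pochhammer_rec Y_def)
    show ?thesis unfolding e1 e2 using b Y by (simp add: field_simps)
  qed
  finally show ?case by (simp add: b_def)
qed

text \<open>Formulated for all nonzero \<open>x\<close>, since the induction step differentiates in
  \<open>x\<close>, and for arbitrary \<open>e\<close> and \<open>p\<close>, since it flips the
  parity and raises the exponent.\<close>

lemma (in rotation_invariant_sphere) integral_signed_powr_solid_harmonic:
  assumes "solid_harmonic l P" "p > -1" "x \<noteq> 0"
  shows "(\<integral>v. signed_powr e p (x \<bullet> v) * P v \<partial>M) =
     abs_powr_multiplier CARD('d) e l p * (norm x powr (p - real l) * P x)"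
  using assms
proof (induction l arbitrary: P e p x)
  case (0 P e p x)
  have c: "P v = P 0" for v by (rule solid_harmonic_0[OF 0(1)])
  have "(\<integral>v. signed_powr e p (x \<bullet> v) * P v \<partial>M) = (\<integral>v. signed_powr e p (x \<bullet> v) * P 0 \<partial>M)"
    by (rule Bochner_Integration.integral_cong[OF refl]) (metis c)
  then show ?case using c[of x] by (simp add: integral_signed_powr[OF 0(2,3)])
next
  case (Suc l P e p x)
  note p = Suc.prems(2) and x = Suc.prems(3)
  have sh: "solid_harmonic l (partial i P)" for i by (rule solid_harmonic_partial[OF Suc.prems(1)])
  have P: "real_polynomial_function P" and lap: "(\<Sum>i\<in>UNIV. partial i (partial i P) x) = 0"
    using Suc.prems(1) by (auto simp: solid_harmonic_def)
  note euler = euler_solid_harmonic[OF Suc.prems(1)]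
  \<comment> \<open>The exponent of the norm in the induction hypothesis at degree \<open>l\<close>
    and exponent \<open>p + 1\<close>.\<close>
  define q where "q = p + 1 - real l"
  define L where "L = abs_powr_multiplier CARD('d) (\<not> e) l (p + 1)"
  define I where "I i = (\<integral>v. signed_powr e p (x \<bullet> v) * (v $ i * partial i P v) \<partial>M)" for i
  have I: "(p + 1) * I i = L * (q * norm x powr (q - 2) * (x $ i * partial i P x) + norm x powr q * partial i (partial i P) x)" for i
  proof -
    let ?y = "\<lambda>t. x + t *\<^sub>R axis i 1"
    have ev: "eventually (\<lambda>t. ?y t \<noteq> 0) (nhds 0)"
      by (rule tendsto_imp_eventually_ne[where c = x]) (use x in \<open>auto intro!: tendsto_eq_intros filterlim_ident\<close>)
    have "((\<lambda>t. \<integral>v. signed_powr (\<not> e) (p + 1) (?y t \<bullet> v) * partial i P v \<partial>M) has_real_derivative (p + 1) * I i) (at 0)"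
      unfolding I_def by (rule has_real_derivative_integral_signed_powr[OF p x solid_harmonic_continuous[OF sh]])
    moreover have "eventually (\<lambda>t. (\<integral>v. signed_powr (\<not> e) (p + 1) (?y t \<bullet> v) * partial i P v \<partial>M) =
        L * ((?y t \<bullet> ?y t) powr (q / 2) * partial i P (?y t))) (nhds 0)"
      using ev
    proof eventually_elim
      case (elim t)
      \<comment> \<open>The norm is expressed through the inner product, which is a polynomial in
        \<open>t\<close> and easy to differentiate.\<close>
      have "(?y t \<bullet> ?y t) powr (q / 2) = norm (?y t) powr q"
        using powr_powr[of "norm (?y t)" 2 "q / 2"] by (simp add: dot_square_norm)
      then show ?case
        using Suc.IH[OF sh, of "p + 1" "?y t" "\<not> e" i] p elim by (simp add: L_def q_def)
    qed
    ultimately have "((\<lambda>t. L * ((?y t \<bullet> ?y t) powr (q / 2) * partial i P (?y t))) has_real_derivative (p + 1) * I i) (at 0)"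
      by (subst (asm) DERIV_cong_ev[OF refl _ refl])
    moreover have "((\<lambda>t. L * ((?y t \<bullet> ?y t) powr (q / 2) * partial i P (?y t))) has_real_derivative
        L * ((x \<bullet> x) powr (q / 2 - 1) * (q / 2) * (2 * x $ i) * partial i P x + (x \<bullet> x) powr (q / 2) * partial i (partial i P) x)) (at 0)"
    proof -
      have e: "(\<lambda>t. ?y t \<bullet> ?y t) = (\<lambda>t. x \<bullet> x + 2 * t * x $ i + t\<^sup>2)"
        by (auto simp: inner_add_left inner_add_right inner_axis inner_axis' inner_axis_axis power2_eq_square algebra_simps)
      have "((\<lambda>t. ?y t \<bullet> ?y t) has_real_derivative 2 * x $ i) (at 0)"
        unfolding e by (auto intro!: derivative_eq_intros)
      then have "((\<lambda>t. (?y t \<bullet> ?y t) powr (q / 2)) has_real_derivative (q / 2) * (x \<bullet> x) powr (q / 2 - 1) * (2 * x $ i)) (at 0)"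
      proof (rule DERIV_chain2[rotated])
        have "x \<bullet> x > 0" using x by simp
        from has_real_derivative_powr[OF this, of "q / 2"]
        show "((\<lambda>z. z powr (q / 2)) has_real_derivative (q / 2) * (x \<bullet> x) powr (q / 2 - 1)) (at (?y 0 \<bullet> ?y 0))"
          by simp
      qed
      from DERIV_cmult[OF DERIV_mult[OF this has_real_derivative_partial[OF real_polynomial_function_partial[OF P]]], of L]
      show ?thesis by (simp add: algebra_simps)
    qed
    ultimately have "(p + 1) * I i = L * ((x \<bullet> x) powr (q / 2 - 1) * (q / 2) * (2 * x $ i) * partial i P x + (x \<bullet> x) powr (q / 2) * partial i (partial i P) x)"
      by (rule DERIV_unique)
    moreover have "(x \<bullet> x) powr (q / 2 - 1) = norm x powr (q - 2)" "(x \<bullet> x) powr (q / 2) = norm x powr q"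
      using powr_powr[of "norm x" 2 "q / 2 - 1"] powr_powr[of "norm x" 2 "q / 2"] by (simp_all add: dot_square_norm)
    ultimately show ?thesis by (simp add: mult_ac)
  qed
  \<comment> \<open>Euler's identity is applied under the integral at \<open>v\<close>; after the
    derivatives are computed it is applied once more, at \<open>x\<close>.\<close>
  have "real (Suc l) * (\<integral>v. signed_powr e p (x \<bullet> v) * P v \<partial>M) = (\<integral>v. (\<Sum>i\<in>UNIV. signed_powr e p (x \<bullet> v) * (v $ i * partial i P v)) \<partial>M)"
    unfolding integral_mult_right_zero[symmetric] sum_distrib_left[symmetric] euler
    by (simp only: mult.left_commute)
  also have "\<dots> = (\<Sum>i\<in>UNIV. I i)"
    unfolding I_def
    by (intro Bochner_Integration.integral_sum integrable_signed_powr_mult p x continuous_on_mult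
        solid_harmonic_continuous[OF sh] continuous_on_component continuous_on_id)
  finally have "(p + 1) * (real (Suc l) * (\<integral>v. signed_powr e p (x \<bullet> v) * P v \<partial>M)) = (\<Sum>i\<in>UNIV. (p + 1) * I i)"
    by (simp add: sum_distrib_left)
  also have "\<dots> = L * (q * norm x powr (q - 2) * (\<Sum>i\<in>UNIV. x $ i * partial i P x) + norm x powr q * (\<Sum>i\<in>UNIV. partial i (partial i P) x))"
    by (simp only: I sum_distrib_left[symmetric] sum.distrib)
  \<comment> \<open>Harmonicity removes the second-order sum, and Euler's identity evaluates the
    other.\<close>
  also have "\<dots> = L * (q * norm x powr (q - 2) * (real (Suc l) * P x))"
    by (simp only: lap euler mult_zero_right add_0_right)
  finally have *: "real (Suc l) * ((p + 1) * (\<integral>v. signed_powr e p (x \<bullet> v) * P v \<partial>M)) = real (Suc l) * (L * q * norm x powr (q - 2) * P x)"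
    by (simp only: mult_ac)
  have "(p + 1) * (\<integral>v. signed_powr e p (x \<bullet> v) * P v \<partial>M) = L * q * norm x powr (q - 2) * P x"
    using mult_left_cancel[of "real (Suc l)"] * by simp
  then have "(\<integral>v. signed_powr e p (x \<bullet> v) * P v \<partial>M) = q / (p + 1) * L * (norm x powr (q - 2) * P x)"
    using p by (simp add: field_simps)
  moreover have "q - 2 = p - real (Suc l)" by (simp add: q_def)
  ultimately show ?case by (simp only: abs_powr_multiplier.simps L_def q_def)
qed

section \<open>Transfer to measures on the sphere and uniqueness of the multiplier\<close>

lemma rotation_invariant_sphere_distr:
  fixes \<sigma> :: "(real ^ 'd) measure"
  assumes "CARD('d) \<ge> 2" and \<sigma>: "rotation_invariant_sphere_prob \<sigma>"
  shows "(\<lambda>x. x) \<in> borel_measurable \<sigma>" and "rotation_invariant_sphere (distr \<sigma> borel (\<lambda>x. x))"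
proof -
  interpret prob_space \<sigma> using \<sigma> by (simp add: rotation_invariant_sphere_prob_def)
  have sets: "sets \<sigma> = sets (restrict_space borel (sphere 0 1))"
    and rot: "\<And>Q. rotation_matrix Q \<Longrightarrow> distr \<sigma> \<sigma> (\<lambda>v. Q *v v) = \<sigma>"
    using \<sigma> by (auto simp: rotation_invariant_sphere_prob_def)
  have sp: "space \<sigma> = sphere 0 1" using sets_eq_imp_space_eq[OF sets] by (simp add: space_restrict_space)
  have "(\<lambda>x. x) \<in> borel_measurable (restrict_space borel (sphere 0 1))" by (rule measurable_restrict_space1) simp
  then show m [measurable]: "(\<lambda>x. x) \<in> borel_measurable \<sigma>" using measurable_cong_sets[OF sets refl] by blast
  \<comment> \<open>Pushing forward along the inclusion moves the measure from the sphere to the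
    ambient space, as the locale expects.\<close>
  let ?M = "distr \<sigma> borel (\<lambda>x. x)"
  interpret M: prob_space ?M by (rule prob_space_distr) measurable
  show "rotation_invariant_sphere ?M"
  proof
    show "AE v in ?M. norm v = 1" by (subst AE_distr_iff) (auto simp: sp)
    show "distr ?M ?M (\<lambda>v. Q *v v) = ?M" if Q: "rotation_matrix Q" for Q
    proof -
      have m\<sigma>: "(\<lambda>v. Q *v v) \<in> measurable \<sigma> \<sigma>"
        unfolding measurable_cong_sets[OF sets sets]
        by (intro measurable_restrict_space2 measurable_restrict_space1)
          (auto simp: space_restrict_space rotation_matrix_norm[OF Q])
      have "distr ?M ?M (\<lambda>v. Q *v v) = distr ?M borel (\<lambda>v. Q *v v)" by (rule distr_cong) auto
      also have "\<dots> = distr \<sigma> borel ((\<lambda>v. Q *v v) \<circ> (\<lambda>x. x))" by (rule distr_distr) measurable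
      also have "\<dots> = distr \<sigma> borel ((\<lambda>x. x) \<circ> (\<lambda>v. Q *v v))" by (simp add: o_def)
      also have "\<dots> = distr (distr \<sigma> \<sigma> (\<lambda>v. Q *v v)) borel (\<lambda>x. x)" by (rule distr_distr[symmetric, OF m m\<sigma>])
      finally show ?thesis by (simp add: rot[OF Q])
    qed
  qed (use assms(1) in auto)
qed

lemma is_funk_hecke_multiplier_abs_powr:
  fixes \<sigma> :: "(real ^ 'd) measure"
  assumes "CARD('d) \<ge> 2" and \<sigma>: "rotation_invariant_sphere_prob \<sigma>" and p: "p > -1"
  shows "is_funk_hecke_multiplier \<sigma> (abs_powr p) l (abs_powr_multiplier CARD('d) False l p)"
  unfolding is_funk_hecke_multiplier_def
proof (intro ballI)
  fix Y :: "real ^ 'd \<Rightarrow> real" and u :: "real ^ 'd"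
  assume "Y \<in> spherical_harmonics l" and u: "u \<in> sphere 0 1"
  then obtain P where Y: "Y = restrict P (sphere 0 1)" and P: "solid_harmonic l P"
    by (auto simp: spherical_harmonics_def intro: solid_harmonic_if_harmonic)
  let ?M = "distr \<sigma> borel (\<lambda>x. x)"
  note m [measurable] = rotation_invariant_sphere_distr(1)[OF assms(1,2)]
  interpret rotation_invariant_sphere ?M by (rule rotation_invariant_sphere_distr[OF assms(1,2)])
  have sp: "space \<sigma> = sphere 0 1"
    using \<sigma> sets_eq_imp_space_eq[of \<sigma> "restrict_space borel (sphere 0 1)"]
    by (simp add: rotation_invariant_sphere_prob_def space_restrict_space)
  have u0: "u \<noteq> 0" "norm u = 1" using u by auto
  have [measurable]: "P \<in> borel_measurable borel"
    by (intro borel_measurable_continuous_onI solid_harmonic_continuous[OF P])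
  \<comment> \<open>\<open>Y\<close> is \<open>undefined\<close> off the sphere, but the space of
    \<open>\<sigma>\<close> is exactly the sphere.\<close>
  have eq: "abs_powr p (u \<bullet> v) * Y v = signed_powr False p (u \<bullet> v) * P v" if "v \<in> space \<sigma>" for v
    using that by (simp add: Y sp signed_powr_def)
  have "integrable ?M (\<lambda>v. signed_powr False p (u \<bullet> v) * P v)"
    by (rule integrable_signed_powr_mult[OF p u0(1) solid_harmonic_continuous[OF P]])
  then have "integrable \<sigma> (\<lambda>v. signed_powr False p (u \<bullet> v) * P v)"
    by (subst (asm) integrable_distr_eq) auto
  moreover have "(\<integral>v. signed_powr False p (u \<bullet> v) * P v \<partial>\<sigma>) = abs_powr_multiplier CARD('d) False l p * P u"
    using integral_signed_powr_solid_harmonic[OF P p u0(1), of False] u0(2)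
    by (subst (asm) integral_distr) auto
  moreover have "Y u = P u" using u by (simp add: Y)
  ultimately show "integrable \<sigma> (\<lambda>v. abs_powr p (u \<bullet> v) * Y v) \<and>
      (\<integral>v. abs_powr p (u \<bullet> v) * Y v \<partial>\<sigma>) = abs_powr_multiplier CARD('d) False l p * Y u"
    using Bochner_Integration.integrable_cong[OF refl eq, of \<sigma> "\<lambda>v. v"]
      Bochner_Integration.integral_cong[OF refl eq, of \<sigma> "\<lambda>v. v"]
    by simp
qed

text \<open>Two multipliers are compared at a point where some spherical harmonic of degree
  \<open>l\<close> does not vanish; this makes the \<open>THE\<close> in the definition well
  determined.\<close>

lemma funk_hecke_multiplier_unique:
  fixes \<sigma> :: "(real ^ 'd) measure"
  assumes "CARD('d) \<ge> 2" and c: "is_funk_hecke_multiplier \<sigma> \<psi> l c"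
  shows "\<exists>!c. is_funk_hecke_multiplier \<sigma> \<psi> l c" and "funk_hecke_multiplier \<sigma> \<psi> l = c"
proof -
  obtain Y and u :: "real ^ 'd" where Y: "Y \<in> spherical_harmonics l" "u \<in> sphere 0 1" "Y u \<noteq> 0"
    using nonzero_spherical_harmonic_exists[OF assms(1)] by blast
  have u: "c' = c" if "is_funk_hecke_multiplier \<sigma> \<psi> l c'" for c'
  proof -
    have "(\<integral>v. \<psi> (u \<bullet> v) * Y v \<partial>\<sigma>) = c' * Y u" "(\<integral>v. \<psi> (u \<bullet> v) * Y v \<partial>\<sigma>) = c * Y u"
      using that c Y(1,2) unfolding is_funk_hecke_multiplier_def by blast+
    then have "c' * Y u = c * Y u" by (rule trans[OF sym])
    then show ?thesis using Y(3) by simp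
  qed
  show "\<exists>!c. is_funk_hecke_multiplier \<sigma> \<psi> l c" using c u by blast
  show "funk_hecke_multiplier \<sigma> \<psi> l = c"
    unfolding funk_hecke_multiplier_def using c u by (rule the_equality)
qed

theorem proposition4p1:
  fixes \<sigma> :: "(real ^ 'd) measure" and p :: real and n :: nat
  assumes "CARD('d) \<ge> 2"
    and "rotation_invariant_sphere_prob \<sigma>"
    and "p > -1"
  shows "(\<exists>!c. is_funk_hecke_multiplier \<sigma> (abs_powr p) (2 * n) c) \<and>
         funk_hecke_multiplier \<sigma> (abs_powr p) (2 * n) =
           funk_hecke_const CARD('d) p *
             ((-1) ^ n * pochhammer (- p / 2) n / pochhammer ((real CARD('d) + p) / 2) n) \<and>
         (\<exists>!c. is_funk_hecke_multiplier \<sigma> (abs_powr p) (2 * n + 1) c) \<and>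
         funk_hecke_multiplier \<sigma> (abs_powr p) (2 * n + 1) = 0"
proof -
  note * = funk_hecke_multiplier_unique[OF assms(1) is_funk_hecke_multiplier_abs_powr[OF assms]]
  have "0 < CARD('d)" by simp
  then show ?thesis
    using *(1)[of "2 * n"] *(2)[of "2 * n"] *(1)[of "2 * n + 1"] *(2)[of "2 * n + 1"]
    unfolding abs_powr_multiplier_odd abs_powr_multiplier_even[OF \<open>0 < CARD('d)\<close> assms(3)] by blast
qed

end
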